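(* For integers $N\ge 1$ and $1\le n\le N$ let $$a_{n,N}:=(-1)^n\,\frac{\binom{2N}{N-n}}{\binom{2N}{N}} .$$ Then, for every $N\ge1$, for $\varepsilon_1,\dots,\varepsilon_N$ independent standard exponential random variables and all complex $s$ with $\Re s>-2N$, $$E\left[\left(\frac{2}{\pi^2}\sum_{n=1}^N\frac{\varepsilon_n}{n^2}\right)^{s/2}\right] = -s\,\frac{2^{s/2}}{\pi^s}\,\Gamma\!\left(\frac s2\right)\sum_{n=1}^N\frac{a_{n,N}}{n^s},$$ where at $s=0,-2,-4,\dots,-2(N-1)$ the right-hand side is defined by continuity. Moreover $$\sum_{n=1}^N\frac{a_{n,N}}{n^s}\longrightarrow (2^{1-s}-1)\,\zeta(s)\quad\text{as } N\to\infty,$$ uniformly on every compact subset of $\mathbb{C}$.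
   Context: $\zeta$ is the Riemann zeta function, meromorphically continued to $\mathbb{C}$ with its only pole (simple) at $s=1$; $(2^{1-s}-1)\zeta(s)$ is regarded as an entire function (value at $s=1$ by continuity). A standard exponential variable $\varepsilon$ satisfies $P(\varepsilon\ge x)=e^{-x}$ for $x\ge0$. *)

theory Defs
  imports "HOL-Probability.Probability" "HOL-Complex_Analysis.Complex_Analysis"
begin

(* The analytic continuation of the Dirichlet series to the punctured plane, which is unique by
   the identity theorem. The clause at the pole only fixes a junk value, making f unique as a
   total function. The series is indexed from 0, hence the Suc. *)
definition zeta :: "complex \<Rightarrow> complex" where
  "zeta = (THE f. f holomorphic_on - {1}
             \<and> (\<forall>s. Re s > 1 \<longrightarrow> (\<lambda>n. 1 / of_nat (Suc n) powr s) sums f s)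
             \<and> f 1 = 0)"

(* remove_sings replaces the value at a removable singularity by the limit there; here this
   concerns only s = 1, where zeta has its pole. *)
definition entire_zeta :: "complex \<Rightarrow> complex" where
  "entire_zeta = remove_sings (\<lambda>s. (2 powr (1 - s) - 1) * zeta s)"

definition a_coeff :: "nat \<Rightarrow> nat \<Rightarrow> real" where
  "a_coeff n N = (-1) ^ n * (real ((2 * N) choose (N - n)) / real ((2 * N) choose N))"

definition dirichlet_sum :: "nat \<Rightarrow> complex \<Rightarrow> complex" where
  "dirichlet_sum N s = (\<Sum>n=1..N. of_real (a_coeff n N) / of_nat n powr s)"

(* Gamma is 0 at its poles in the library, so at s = 0, -2, ..., -2(N-1) the bare formula would
   have the wrong value; remove_sings takes the limit there and changes nothing at the points
   with Re s > -2N where Gamma (s / 2) is regular. *)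
definition moment_formula :: "nat \<Rightarrow> complex \<Rightarrow> complex" where
  "moment_formula N =
     remove_sings (\<lambda>s. - s * (2 powr (s / 2) / of_real pi powr s) * Gamma (s / 2) * dirichlet_sum N s)"

end

theory Submission
  imports Defs "HOL-Real_Asymp.Real_Asymp"
begin

text \<open>
  Write \<open>S\<^sub>N = \<Sum>n\<le>N. \<epsilon>\<^sub>n / n\<^sup>2\<close> and \<open>D\<^sub>N\<close> for \<open>dirichlet_sum N\<close>. Everything rests on the recursion
  \<open>a(n,N+1) ((N+1)\<^sup>2 - n\<^sup>2) = (N+1)\<^sup>2 a(n,N)\<close> (lemma \<open>a_coeff_Suc\<close>), which is used in three guises.

  \<^item> For the exponential sums \<open>h\<^sub>N(x) = - 2 (\<Sum>n\<le>N. a(n,N) n\<^sup>2 exp (- n\<^sup>2 x))\<close> it is the differential equation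
    \<open>h\<^sub>N\<^sub>+\<^sub>1' = (N+1)\<^sup>2 (h\<^sub>N - h\<^sub>N\<^sub>+\<^sub>1)\<close>. With \<open>h\<^sub>N\<^sub>+\<^sub>1(0) = 0\<close>, for \<open>N \<ge> 1\<close>, this says that \<open>h\<^sub>N\<^sub>+\<^sub>1\<close> is the convolution of
    \<open>h\<^sub>N\<close> with the density of \<open>\<epsilon>\<^sub>N\<^sub>+\<^sub>1 / (N+1)\<^sup>2\<close>, so \<open>h\<^sub>N\<close> is the density of \<open>S\<^sub>N\<close>.

  \<^item> For the power sums \<open>\<Sum>n\<le>N. a(n,N) n\<^bsup>2j\<^esup>\<close> it shows that they vanish for \<open>1 \<le> j < N\<close>; in other words
    \<open>h\<^sub>N\<close> has a zero of order \<open>N - 1\<close> at the origin.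

  \<^item> For the Dirichlet polynomials it is \<open>D\<^sub>N\<^sub>+\<^sub>1(s) - D\<^sub>N(s) = D\<^sub>N\<^sub>+\<^sub>1(s - 2) / (N+1)\<^sup>2\<close>.

  The moment \<open>M\<^sub>N(w) = \<integral> x\<^bsup>w\<^esup> h\<^sub>N(x) dx\<close> is \<open>- 2 \<Gamma>(w+1) D\<^sub>N(2w)\<close> for \<open>Re w > - 1\<close>, by integrating term by
  term. The zero of \<open>h\<^sub>N\<close> at the origin makes the integral converge for \<open>Re w > - N\<close>, and repeated
  integration by parts carries the formula there, except at the poles of \<open>\<Gamma>(w+1)\<close>. At these, dominated
  convergence shows that \<open>M\<^sub>N\<close> is continuous, so it takes the value that the right-hand side has by
  continuity.

  For the convergence, the third form of the recursion reduces everything to a bound on \<open>D\<^sub>N(s - 2)\<close> that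
  is uniform in \<open>N\<close> and locally uniform in \<open>s\<close>, because then the increments of \<open>D\<^sub>N(s)\<close> are \<open>O(1/N\<^sup>2)\<close>.
  Such a bound is out of reach term by term, since for negative \<open>Re s\<close> the sum lives on cancellation; it
  comes from \<open>D\<^sub>N(2w) = - M\<^sub>N(w) / (2 \<Gamma>(w+1))\<close> and the positivity of \<open>h\<^sub>N\<close>. Indeed
  \<open>\<bar>M\<^sub>N(w)\<bar> \<le> M\<^sub>N(- R) + M\<^sub>N(R)\<close> whenever \<open>\<bar>Re w\<bar> \<le> R < N\<close>. For \<open>R > 1/2\<close> the moment \<open>M\<^sub>N(R)\<close> is bounded
  because \<open>\<bar>a(n,N)\<bar> \<le> 1\<close>, and once \<open>N > R\<close> the moment \<open>M\<^sub>N(- R)\<close> decreases in \<open>N\<close>, reflecting that \<open>S\<^sub>N\<close>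
  increases (lemma \<open>hypo_moment_bounded\<close>). The limit of \<open>D\<^sub>N\<close> is therefore entire. For \<open>Re s > 1\<close> it equals
  \<open>\<Sum>n. (-1)\<^sup>n / n\<^sup>s = (2\<^bsup>1-s\<^esup> - 1) \<zeta>(s)\<close>, since \<open>a(n,N) \<longlonglongrightarrow> (-1)\<^sup>n\<close>, and analytic continuation
  gives the equality everywhere. The entire limit also serves to construct the continuation of the zeta
  function to the left of the line \<open>Re s = 1\<close>.
\<close>


section \<open>The coefficients\<close>

text \<open>
  In factorials, \<open>a(n,N) = (-1)\<^sup>n N!\<^sup>2 / ((N - n)! (N + n)!)\<close>; raising \<open>N\<close> by one multiplies this by
  \<open>(N + 1)\<^sup>2 / ((N + 1 - n) (N + 1 + n))\<close>.
\<close>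
lemma a_coeff_Suc:
  assumes "n \<le> N"
  shows "a_coeff n (Suc N) * ((real (Suc N))\<^sup>2 - (real n)\<^sup>2) = (real (Suc N))\<^sup>2 * a_coeff n N"
proof -
  have 1: "real ((2*N) choose (N-n)) = fact (2*N) / (fact (N-n) * fact (N+n))"
    using assms by (subst binomial_fact) (auto simp: mult_2 intro!: arg_cong[where f=fact])
  have 2: "real ((2*N) choose N) = fact (2*N) / (fact N * fact N)"
    by (subst binomial_fact) (auto simp: mult_2)
  have e: "2 * Suc N - Suc (N - n) = Suc (N + n)" "Suc N - n = Suc (N - n)" "2 * Suc N - Suc N = Suc N"
    using assms by auto
  have l: "Suc N - n \<le> 2 * Suc N" "Suc N \<le> 2 * Suc N" by simp_all
  have 3: "real ((2*Suc N) choose (Suc N-n)) = fact (2*Suc N) / (fact (Suc (N-n)) * fact (Suc (N+n)))"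
    unfolding binomial_fact[OF l(1)] by (simp only: e)
  have 4: "real ((2*Suc N) choose Suc N) = fact (2*Suc N) / (fact (Suc N) * fact (Suc N))"
    unfolding binomial_fact[OF l(2)] by (simp only: e)
  have 5: "(real (Suc N))\<^sup>2 - (real n)\<^sup>2 = real (Suc (N-n)) * real (Suc (N+n))"
    using assms by (simp add: of_nat_diff power2_eq_square algebra_simps)
  have "a_coeff n (Suc N) = (-1)^n * (fact (Suc N) * fact (Suc N) / (fact (Suc (N-n)) * fact (Suc (N+n))))"
    unfolding a_coeff_def 3 4 by (simp del: fact_Suc mult_Suc_right)
  also have "\<dots> = (-1)^n * (real (Suc N) * real (Suc N) * (fact N * fact N) / (real (Suc (N-n)) * real (Suc (N+n)) * (fact (N-n) * fact (N+n))))"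
    by (simp only: fact_Suc of_nat_mult of_nat_fact mult_ac)
  finally have L: "a_coeff n (Suc N) = \<dots>" .
  have R: "a_coeff n N = (-1)^n * (fact N * fact N / (fact (N-n) * fact (N+n)))"
    unfolding a_coeff_def 1 2 by simp
  have nz: "real (Suc (N-n)) \<noteq> 0" "real (Suc (N+n)) \<noteq> 0" by simp_all
  have cancel: "t * (S * S * F / (p * q * G)) * (p * q) = S * S * (t * (F / G))"
    if "p \<noteq> 0" "q \<noteq> 0" for t S F G p q :: real
    using that by simp
  show ?thesis unfolding L R 5 by (subst cancel[OF nz]) (simp only: power2_eq_square)
qed

lemma abs_a_coeff_le_1: "\<bar>a_coeff n N\<bar> \<le> 1"
proof -
  have "(2*N) choose (N-n) \<le> (2*N) choose N"
    using binomial_maximum'[of N "N-n"] by simp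
  thus ?thesis by (simp add: a_coeff_def abs_mult power_abs divide_le_eq)
qed

text \<open>
  Consecutive coefficients have ratio \<open>a(n+1,N) / a(n,N) = - (N - n) / (N + n + 1)\<close>, which tends to \<open>- 1\<close>.
\<close>
lemma a_coeff_tendsto: "(\<lambda>N. a_coeff n N) \<longlonglongrightarrow> (-1) ^ n"
proof (induction n)
  case 0
  have "a_coeff 0 N = 1" for N by (simp add: a_coeff_def)
  thus ?case by simp
next
  case (Suc n)
  have "(\<lambda>N. a_coeff n N * (- ((real N - real n) / (real N + real n + 1)))) \<longlonglongrightarrow> (-1)^n * (-1)"
  proof (intro tendsto_mult Suc)
    show "(\<lambda>N. - ((real N - real n) / (real N + real n + 1))) \<longlonglongrightarrow> - 1" by real_asymp
  qed
  moreover have "\<forall>\<^sub>F N in sequentially. a_coeff n N * (- ((real N - real n) / (real N + real n + 1))) = a_coeff (Suc n) N"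
    using eventually_ge_at_top[of "Suc n"]
  proof eventually_elim
    case (elim N)
    have "Suc (N - Suc n) * ((2*N) choose (Suc (N - Suc n))) = (2*N - (N - Suc n)) * ((2*N) choose (N - Suc n))"
      by (simp only: binomial_absorption binomial_absorb_comp)
    moreover have "Suc (N - Suc n) = N - n" "2*N - (N - Suc n) = N + n + 1" using elim by auto
    ultimately have "(N-n) * ((2*N) choose (N-n)) = (N+n+1) * ((2*N) choose (N - Suc n))" by simp
    hence "real (N-n) * real ((2*N) choose (N-n)) = real (N+n+1) * real ((2*N) choose (N - Suc n))"
      by (metis of_nat_mult)
    hence "(real N-real n) * real ((2*N) choose (N-n)) = (real N+real n+1) * real ((2*N) choose (N - Suc n))"
      using elim by (simp add: of_nat_diff)
    hence "real ((2*N) choose (N - Suc n)) = (real N-real n) / (real N+real n+1) * real ((2*N) choose (N-n))"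
      by (simp add: field_simps)
    thus ?case unfolding a_coeff_def by (simp add: mult_ac)
  qed
  ultimately show ?case by (simp add: tendsto_cong)
qed

definition power_sum :: "nat \<Rightarrow> nat \<Rightarrow> real" where
  "power_sum j N = (\<Sum>n=1..N. a_coeff n N * (real n)^(2*j))"

text \<open>
  Reversing the sum turns it into a partial alternating sum of a row of Pascal's triangle, which stops
  just before the middle entry and equals half of that entry up to sign.
\<close>
lemma sum_a_coeff:
  assumes "N \<ge> 1" shows "(\<Sum>n=1..N. a_coeff n N) = -1/2"
proof -
  let ?c = "\<lambda>k. (-1)^k * real ((2*N) choose k)"
  have "(\<Sum>n=1..N. (-1)^n * real ((2*N) choose (N-n))) = (\<Sum>k<N. (-1)^N * ?c k)"
  proof (rule sum.reindex_bij_witness[of _ "\<lambda>k. N-k" "\<lambda>n. N-n"])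
    fix n assume n: "n \<in> {1..N}"
    then obtain k where k: "N = n + k" by (metis atLeastAtMost_iff le_Suc_ex)
    have "(-1::real)^k * (-1)^k = 1" by (simp flip: power_mult_distrib)
    thus "(-1)^N * ?c (N-n) = (-1)^n * real ((2*N) choose (N-n))" by (simp add: k power_add)
  qed (use assms in auto)
  also have "\<dots> = (-1)^N * (\<Sum>k\<le>N-1. (real (2*N) gchoose k) * (-1)^k)"
    unfolding sum_distrib_left using assms
    by (intro sum.cong) (auto simp: binomial_gbinomial)
  also have "\<dots> = (-1)^N * (-1)^(N-1) * (real (2*N-1) gchoose (N-1))"
    using assms by (subst gbinomial_sum_lower_neg) (simp add: of_nat_diff)
  also have "\<dots> = - real ((2*N-1) choose (N-1))"
    using assms by (cases N) (auto simp: binomial_gbinomial simp flip: power_mult_distrib)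
  finally have *: "(\<Sum>n=1..N. (-1)^n * real ((2*N) choose (N-n))) = - real ((2*N-1) choose (N-1))" .
  obtain m where m: "N = Suc m" using assms by (cases N) auto
  have "(2*N) choose N = 2 * ((2*N-1) choose (N-1))"
  proof -
    have "Suc (2*m+1) choose Suc m = (2*m+1 choose m) + (2*m+1 choose Suc m)"
      by (rule binomial_Suc_Suc)
    also have "(2*m+1 choose Suc m) = (2*m+1 choose m)"
      by (subst binomial_symmetric) auto
    finally show ?thesis unfolding m by simp
  qed
  moreover have "(\<Sum>n=1..N. a_coeff n N) = (\<Sum>n=1..N. (-1)^n * real ((2*N) choose (N-n))) / real ((2*N) choose N)"
    unfolding a_coeff_def sum_divide_distrib by simp
  moreover have "real ((2*N-1) choose (N-1)) > 0" using assms by simp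
  ultimately show ?thesis unfolding * by simp
qed

lemma power_sum_0: "N \<ge> 1 \<Longrightarrow> power_sum 0 N = -1/2"
  using sum_a_coeff by (simp add: power_sum_def)

lemma power_sum_Suc:
  "power_sum (Suc j) (Suc N) = (real (Suc N))\<^sup>2 * (power_sum j (Suc N) - power_sum j N)"
proof -
  have "(real (Suc N))\<^sup>2 * power_sum j (Suc N) - power_sum (Suc j) (Suc N)
     = (\<Sum>n=1..Suc N. a_coeff n (Suc N) * ((real (Suc N))\<^sup>2 - (real n)\<^sup>2) * (real n)^(2*j))"
    unfolding power_sum_def sum_distrib_left sum_subtractf[symmetric]
    by (intro sum.cong) (auto simp: algebra_simps power2_eq_square power_add)
  \<comment> \<open>The last term vanishes. It has to go first, as truncated subtraction makes \<open>a(N+1,N)\<close> nonzero.\<close>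
  also have "\<dots> = (\<Sum>n=1..N. a_coeff n (Suc N) * ((real (Suc N))\<^sup>2 - (real n)\<^sup>2) * (real n)^(2*j))"
    by simp
  also have "\<dots> = (\<Sum>n=1..N. ((real (Suc N))\<^sup>2 * a_coeff n N) * (real n)^(2*j))"
    by (intro sum.cong refl) (subst a_coeff_Suc, auto)
  also have "\<dots> = (real (Suc N))\<^sup>2 * power_sum j N"
    by (simp only: power_sum_def sum_distrib_left mult.assoc)
  finally show ?thesis by (simp add: algebra_simps)
qed

text \<open>
  By the recursion, \<open>power_sum (j + 1) (N + 1)\<close> is a multiple of the increment of \<open>power_sum j\<close> from \<open>N\<close> to
  \<open>N + 1\<close>. For \<open>j = 0\<close> both values are \<open>- 1 / 2\<close>, for larger \<open>j\<close> both are \<open>0\<close>.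
\<close>
lemma power_sum_eq_0: "1 \<le> j \<Longrightarrow> j < N \<Longrightarrow> power_sum j N = 0"
proof (induction j arbitrary: N)
  case (Suc j)
  then obtain M where M: "N = Suc M" by (cases N) auto
  have "power_sum j (Suc M) = power_sum j M"
    using Suc M by (cases "j = 0") (auto simp: power_sum_0)
  thus ?case by (simp add: M power_sum_Suc)
qed auto

text \<open>
  The engine of the convergence proof: the increment in \<open>N\<close> at \<open>s\<close> is controlled by the size at \<open>s - 2\<close>.
\<close>
lemma dirichlet_sum_Suc:
  "dirichlet_sum (Suc N) s = dirichlet_sum N s + dirichlet_sum (Suc N) (s - 2) / of_nat (Suc N) ^ 2"
proof -
  have pw: "of_nat n powr (s - 2) = of_nat n powr s / of_nat n ^ 2" if "n \<ge> 1" for n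
    using that by (simp add: powr_diff)
  have "of_nat (Suc N)^2 * dirichlet_sum (Suc N) s - dirichlet_sum (Suc N) (s-2)
     = (\<Sum>n=1..Suc N. of_real (a_coeff n (Suc N) * ((real (Suc N))\<^sup>2 - (real n)\<^sup>2)) / of_nat n powr s)"
    unfolding dirichlet_sum_def sum_distrib_left sum_subtractf[symmetric]
    by (intro sum.cong refl, subst pw) (simp_all add: diff_divide_distrib algebra_simps)
  also have "\<dots> = (\<Sum>n=1..N. of_real (a_coeff n (Suc N) * ((real (Suc N))\<^sup>2 - (real n)\<^sup>2)) / of_nat n powr s)"
    by simp
  also have "\<dots> = (\<Sum>n=1..N. of_real ((real (Suc N))\<^sup>2 * a_coeff n N) / of_nat n powr s)"
    by (intro sum.cong refl) (subst a_coeff_Suc, auto)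
  also have "\<dots> = of_nat (Suc N)^2 * dirichlet_sum N s"
    by (simp add: dirichlet_sum_def sum_distrib_left algebra_simps)
  finally have "of_nat (Suc N)^2 * dirichlet_sum (Suc N) s - dirichlet_sum (Suc N) (s-2) = of_nat (Suc N)^2 * dirichlet_sum N s" .
  moreover have "(of_nat (Suc N) :: complex)^2 \<noteq> 0" by (simp del: of_nat_Suc)
  ultimately show ?thesis by (simp add: field_simps del: of_nat_Suc)
qed

lemma dirichlet_sum_neg_even: "dirichlet_sum N (- 2 * of_nat j) = of_real (power_sum j N)"
proof -
  have "of_nat n powr (- 2 * of_nat j) = inverse ((of_nat n :: complex) ^ (2*j))" if "n \<ge> 1" for n
    using that powr_nat'[of "of_nat n" "2*j"] by (simp add: powr_minus)
  thus ?thesis unfolding dirichlet_sum_def power_sum_def of_real_sum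
    by (intro sum.cong) (simp_all add: divide_inverse)
qed

lemma dirichlet_sum_holomorphic: "dirichlet_sum N holomorphic_on A"
  unfolding dirichlet_sum_def by (intro holomorphic_intros) auto

section \<open>Exponential sums and their Mellin transforms\<close>

definition exp_sum :: "(nat \<Rightarrow> real) \<Rightarrow> nat \<Rightarrow> real \<Rightarrow> real" where
  "exp_sum c N x = (\<Sum>n=1..N. c n * exp (- ((real n)\<^sup>2 * x)))"

text \<open>
  Up to sign, the sum for \<open>j\<close> is the \<open>j\<close>-th derivative of \<open>exp_sum c N\<close> at the origin, so the condition
  says that this function vanishes there to order \<open>m\<close>.
\<close>
definition derivs_vanish :: "(nat \<Rightarrow> real) \<Rightarrow> nat \<Rightarrow> nat \<Rightarrow> bool" where
  "derivs_vanish c N m \<longleftrightarrow> (\<forall>j<m. (\<Sum>n=1..N. c n * real n ^ (2*j)) = 0)"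

text \<open>
  The exponent is \<open>w\<close> rather than the customary \<open>w - 1\<close> of the Mellin transform, so that for a probability
  density this is the moment of order \<open>w\<close>.
\<close>
definition mellin :: "(nat \<Rightarrow> real) \<Rightarrow> nat \<Rightarrow> complex \<Rightarrow> complex" where
  "mellin c N w = (LINT x:{0<..}|lborel. of_real (exp_sum c N x) * of_real x powr w)"

lemma exp_sum_deriv:
  "(exp_sum c N has_real_derivative exp_sum (\<lambda>n. - ((real n)\<^sup>2 * c n)) N x) (at x within A)"
  unfolding exp_sum_def
  by (auto intro!: derivative_eq_intros sum.cong simp: algebra_simps)

lemma exp_sum_measurable [measurable]: "exp_sum c N \<in> borel_measurable borel"
  unfolding exp_sum_def by measurable

lemma exp_sum_continuous: "isCont (exp_sum c N) x"
  using exp_sum_deriv DERIV_isCont by blast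

lemma derivs_vanish_deriv:
  assumes "derivs_vanish c N (Suc m)" shows "derivs_vanish (\<lambda>n. - ((real n)\<^sup>2 * c n)) N m"
  unfolding derivs_vanish_def
proof (intro allI impI)
  fix j assume "j < m"
  hence "(\<Sum>n=1..N. c n * real n ^ (2*Suc j)) = 0" using assms unfolding derivs_vanish_def by blast
  moreover have "(\<Sum>n=1..N. - ((real n)\<^sup>2 * c n) * real n ^ (2*j)) = - (\<Sum>n=1..N. c n * real n ^ (2*Suc j))"
    unfolding sum_negf[symmetric] by (intro sum.cong) (auto simp: power2_eq_square)
  ultimately show "(\<Sum>n=1..N. - ((real n)\<^sup>2 * c n) * real n ^ (2*j)) = 0" by simp
qed

lemma exp_sum_bound_exp: "x > 0 \<Longrightarrow> \<bar>exp_sum c N x\<bar> \<le> (\<Sum>n=1..N. \<bar>c n\<bar>) * exp (-x)"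
  unfolding exp_sum_def sum_distrib_right
proof (rule order_trans[OF sum_abs], intro sum_mono)
  fix n assume x: "x > 0" and "n \<in> {1..N}"
  hence "1 \<le> (real n)\<^sup>2" by simp
  hence "1 * x \<le> (real n)\<^sup>2 * x" using x by (intro mult_right_mono) auto
  thus "\<bar>c n * exp (- ((real n)\<^sup>2 * x))\<bar> \<le> \<bar>c n\<bar> * exp (-x)"
    by (auto simp: abs_mult intro!: mult_left_mono)
qed

text \<open>
  Near the origin, the mean value theorem gains one power of \<open>x\<close> for each vanishing derivative. Away from
  it, the slowest of the exponentials is \<open>exp (- x)\<close>, and \<open>x\<^bsup>m\<^esup> \<ge> 1\<close> costs nothing.
\<close>
lemma exp_sum_bound:
  assumes "derivs_vanish c N m"
  shows "\<exists>C\<ge>0. \<forall>x>0. \<bar>exp_sum c N x\<bar> \<le> C * (x^m * exp (-x))"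
  using assms
proof (induction m arbitrary: c)
  case 0
  thus ?case using exp_sum_bound_exp[of _ c N]
    by (intro exI[of _ "\<Sum>n=1..N. \<bar>c n\<bar>"]) (auto simp: sum_nonneg)
next
  case (Suc m)
  let ?c = "\<lambda>n. - ((real n)\<^sup>2 * c n)"
  obtain C where C: "C \<ge> 0" "\<And>x. x > 0 \<Longrightarrow> \<bar>exp_sum ?c N x\<bar> \<le> C * (x^m * exp (-x))"
    using Suc.IH[OF derivs_vanish_deriv[OF Suc.prems]] by blast
  define B where "B = (\<Sum>n=1..N. \<bar>c n\<bar>)"
  have B: "B \<ge> 0" by (auto simp: B_def intro: sum_nonneg)
  have zero: "exp_sum c N 0 = 0"
    using Suc.prems by (auto simp: derivs_vanish_def exp_sum_def)
  \<comment> \<open>The factor \<open>exp 1\<close> compensates \<open>exp (- x)\<close> for \<open>x \<le> 1\<close>.\<close>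
  show ?case
  proof (intro exI[of _ "C * exp 1 + B"] conjI allI impI)
    show "0 \<le> C * exp 1 + B" using B C by simp
    fix x :: real assume x: "x > 0"
    show "\<bar>exp_sum c N x\<bar> \<le> (C * exp 1 + B) * (x ^ Suc m * exp (- x))"
    proof (cases "x \<le> 1")
      case True
      obtain z where z: "0 < z" "z < x" "exp_sum c N x - exp_sum c N 0 = (x - 0) * exp_sum ?c N z"
        using MVT2[OF x, of "exp_sum c N" "exp_sum ?c N"] exp_sum_deriv by blast
      have "\<bar>exp_sum c N x\<bar> = x * \<bar>exp_sum ?c N z\<bar>" using z zero x by (simp add: abs_mult)
      also have "\<dots> \<le> x * (C * (x^m * 1))"
        using x z C by (intro mult_left_mono order_trans[OF C(2)] mult_mono power_mono) auto
      also have "\<dots> = C * x ^ Suc m * 1" by simp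
      also have "\<dots> \<le> C * x ^ Suc m * exp (1 - x)" using x True C by (intro mult_left_mono) auto
      also have "\<dots> = C * exp 1 * (x ^ Suc m * exp (- x))" by (simp add: exp_diff exp_minus field_simps)
      also have "\<dots> \<le> (C * exp 1 + B) * (x ^ Suc m * exp (- x))"
        using x B by (intro mult_right_mono) auto
      finally show ?thesis .
    next
      case False
      have "\<bar>exp_sum c N x\<bar> \<le> B * (1 * exp (-x))" using exp_sum_bound_exp[OF x] by (simp add: B_def)
      also have "\<dots> \<le> B * (x ^ Suc m * exp (-x))"
        using False B by (intro mult_left_mono mult_right_mono one_le_power) auto
      also have "\<dots> \<le> (C * exp 1 + B) * (x ^ Suc m * exp (- x))"
        using x B C by (intro mult_right_mono) auto
      finally show ?thesis .
    qed
  qed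
qed

text \<open>
  Euler's integral, rescaled by \<open>t \<mapsto> a t\<close>, as a Lebesgue integral.
\<close>
lemma Gamma_set_integral:
  assumes z: "Re z > 0" and a: "a > 0"
  shows "set_integrable lborel {0<..} (\<lambda>t. of_real (exp (- (a*t))) * of_real t powr (z-1))"
    and "(LINT t:{0<..}|lborel. of_real (exp (- (a*t))) * of_real t powr (z-1)) = Gamma z / of_real a powr z"
proof -
  have int: "set_integrable lborel {0<..} (\<lambda>t. of_real (exp (- (a*t))) * of_real t powr (z-1))"
    if a: "a > 0" for a :: real
  proof -
    have "set_integrable lebesgue {0<..} (\<lambda>t. complex_of_real t powr (z - 1) / of_real (exp (a * t)))"
      using absolutely_integrable_Gamma_integral[OF z a] .
    hence "set_integrable lborel {0<..} (\<lambda>t. complex_of_real t powr (z - 1) / of_real (exp (a * t)))"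
      unfolding set_integrable_def by (subst (asm) integrable_completion) measurable
    thus ?thesis by (simp add: exp_minus divide_inverse mult.commute)
  qed
  show "set_integrable lborel {0<..} (\<lambda>t. of_real (exp (- (a*t))) * of_real t powr (z-1))"
    by (rule int[OF a])
  define f where "f = (\<lambda>t::real. indicator {0<..} t *\<^sub>R (of_real (exp (- t)) * complex_of_real t powr (z-1)))"
  have "(LINT t:{0<..}|lborel. of_real (exp (- (1*t))) * of_real t powr (z-1)) = 
      integral {0<..} (\<lambda>t. of_real (exp (- (1*t))) * of_real t powr (z-1))"
    by (rule set_borel_integral_eq_integral) (rule int, simp)
  also have "\<dots> = Gamma z"
    using integral_unique[OF Gamma_integral_complex'[OF z]]
    by (simp add: exp_minus divide_inverse mult.commute)
  finally have 1: "(\<integral>x. f x \<partial>lborel) = Gamma z"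
    by (simp add: f_def set_lebesgue_integral_def)
  have "Gamma z = a *\<^sub>R (\<integral>x. f (0 + a * x) \<partial>lborel)"
    unfolding 1[symmetric] using a by (subst lborel_integral_real_affine[where c=a and t=0]) auto
  also have "(\<lambda>x. f (0 + a * x)) = (\<lambda>x. of_real a powr (z-1) * (indicator {0<..} x *\<^sub>R (of_real (exp (- (a*x))) * of_real x powr (z-1))))"
    using a by (auto simp: f_def fun_eq_iff indicator_def zero_less_mult_iff powr_times_real)
  also have "a *\<^sub>R (\<integral>x. of_real a powr (z-1) * (indicator {0<..} x *\<^sub>R (of_real (exp (- (a*x))) * of_real x powr (z-1))) \<partial>lborel)
     = of_real a * of_real a powr (z-1) * (LINT t:{0<..}|lborel. of_real (exp (- (a*t))) * of_real t powr (z-1))"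
    by (simp add: set_lebesgue_integral_def scaleR_conv_of_real)
  also have "of_real a * of_real a powr (z-1) = of_real a powr z"
    using a by (simp add: powr_diff)
  finally show "(LINT t:{0<..}|lborel. of_real (exp (- (a*t))) * of_real t powr (z-1)) = Gamma z / of_real a powr z"
    using a by (simp add: field_simps)
qed

lemma Gamma_kernel_integrable:
  assumes "r > -1"
  shows "set_integrable lborel {0<..} (\<lambda>x::real. x powr r * exp (-x))"
proof -
  have "set_integrable lborel {0<..} (\<lambda>t. of_real (exp (- (1*t))) * complex_of_real t powr (of_real (r+1)-1))"
    by (rule Gamma_set_integral) (use assms in auto)
  from integrable_norm[OF this[unfolded set_integrable_def]]
  have "integrable lborel (\<lambda>t::real. indicator {0<..} t *\<^sub>R (t powr r * exp (-t)))"
    by (rule Bochner_Integration.integrable_cong[THEN iffD1, rotated 2])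
       (auto simp: indicator_def norm_mult norm_powr_real_powr)
  thus ?thesis unfolding set_integrable_def .
qed

lemma mellin_bound:
  assumes "derivs_vanish c N m"
  obtains C where "C \<ge> 0"
    "\<And>x w. x > 0 \<Longrightarrow> norm (of_real (exp_sum c N x) * of_real x powr w) \<le> C * (x powr (Re w + m) * exp (-x))"
proof -
  obtain C where C: "C \<ge> 0" "\<And>x. x > 0 \<Longrightarrow> \<bar>exp_sum c N x\<bar> \<le> C * (x^m * exp (-x))"
    using exp_sum_bound[OF assms] by blast
  show thesis
  proof (rule that[OF C(1)])
    fix x :: real and w assume x: "x > 0"
    have "norm (of_real (exp_sum c N x) * of_real x powr w) = \<bar>exp_sum c N x\<bar> * x powr Re w"
      using x by (simp add: norm_mult norm_powr_real_powr)
    also have "\<dots> \<le> C * (x^m * exp (-x)) * x powr Re w" using C(2)[OF x] by (intro mult_right_mono) auto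
    also have "\<dots> = C * (x powr (Re w + m) * exp (-x))"
      using x by (simp add: powr_add powr_realpow)
    finally show "norm (of_real (exp_sum c N x) * of_real x powr w) \<le> \<dots>" .
  qed
qed

lemma mellin_integrable:
  assumes "derivs_vanish c N m" "Re w > - real m - 1"
  shows "set_integrable lborel {0<..} (\<lambda>x. of_real (exp_sum c N x) * of_real x powr w)"
proof -
  obtain C where C: "C \<ge> 0"
    "\<And>x w. x > 0 \<Longrightarrow> norm (of_real (exp_sum c N x) * of_real x powr w) \<le> C * (x powr (Re w + m) * exp (-x))"
    using mellin_bound[OF assms(1)] by blast
  have int: "set_integrable lborel {0<..} (\<lambda>x. C * (x powr (Re w + m) * exp (-x)))"
    using assms by (intro set_integrable_mult_right Gamma_kernel_integrable) auto
  show ?thesis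
    by (rule set_integrable_bound[OF int]) (auto simp: set_borel_measurable_def abs_mult C(1) intro!: C(2))
qed

text \<open>
  Dominated convergence: for exponents near \<open>w\<close>, the power \<open>x\<^bsup>w\<^esup>\<close> is bounded by the sum of two real powers
  of \<open>x\<close>, one governing \<open>x < 1\<close> and the other \<open>x \<ge> 1\<close>, whose exponents still lie in the domain of
  convergence.
\<close>
lemma mellin_continuous:
  assumes "derivs_vanish c N m" "Re w > - real m - 1"
  shows "isCont (mellin c N) w"
proof -
  obtain C where C: "C \<ge> 0"
    "\<And>x w. x > 0 \<Longrightarrow> norm (of_real (exp_sum c N x) * of_real x powr w) \<le> C * (x powr (Re w + m) * exp (-x))"
    using mellin_bound[OF assms(1)] by blast
  \<comment> \<open>Half the distance of \<open>w\<close> from the boundary of the half-plane of convergence.\<close>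
  define d where "d = (Re w + m + 1) / 2"
  have d: "d > 0" using assms by (simp add: d_def)
  define a b where "a = Re w + m - d" and "b = Re w + m + d"
  have ab: "a > -1" "b > -1" using d assms by (auto simp: a_def b_def d_def field_simps)
  let ?g = "\<lambda>x::real. C * (x powr a * exp (-x)) + C * (x powr b * exp (-x))"
  have int: "set_integrable lborel {0<..} ?g"
    using ab by (intro set_integral_add set_integrable_mult_right Gamma_kernel_integrable) auto
  show ?thesis unfolding continuous_at_sequentially
  proof (intro allI impI)
    fix u assume u: "u \<longlonglongrightarrow> w"
    have "(\<lambda>n. Re (u n)) \<longlonglongrightarrow> Re w" using u by (rule tendsto_Re)
    hence "\<forall>\<^sub>F n in sequentially. dist (Re (u n)) (Re w) < d" using d by (rule tendstoD)
    then obtain n0 where n0: "\<And>n. n \<ge> n0 \<Longrightarrow> \<bar>Re (u n) - Re w\<bar> < d"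
      by (auto simp: eventually_at_top_linorder dist_real_def)
    have "(\<lambda>n. mellin c N (u (n + n0))) \<longlonglongrightarrow> mellin c N w"
      unfolding mellin_def set_lebesgue_integral_def
    proof (rule integral_dominated_convergence)
      show "integrable lborel (\<lambda>x. indicator {0<..} x *\<^sub>R ?g x)" using int unfolding set_integrable_def .
      show "AE x in lborel. (\<lambda>n. indicator {0<..} x *\<^sub>R (of_real (exp_sum c N x) * complex_of_real x powr u (n + n0)))
         \<longlonglongrightarrow> indicator {0<..} x *\<^sub>R (of_real (exp_sum c N x) * complex_of_real x powr w)"
      proof (intro always_eventually allI)
        fix x :: real
        show "(\<lambda>n. indicator {0<..} x *\<^sub>R (of_real (exp_sum c N x) * complex_of_real x powr u (n + n0)))
         \<longlonglongrightarrow> indicator {0<..} x *\<^sub>R (of_real (exp_sum c N x) * complex_of_real x powr w)"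
          using LIMSEQ_ignore_initial_segment[OF u, of n0]
          by (cases "x > 0") (auto intro!: tendsto_intros)
      qed
      fix n
      show "AE x in lborel. norm (indicator {0<..} x *\<^sub>R (of_real (exp_sum c N x) * complex_of_real x powr u (n + n0)))
          \<le> indicator {0<..} x *\<^sub>R ?g x"
      proof (intro always_eventually allI)
        fix x :: real
        have *: "x powr (Re (u (n+n0)) + m) \<le> x powr a + x powr b" if "x > 0"
        proof (cases "x \<ge> 1")
          case True
          hence "x powr (Re (u (n+n0)) + m) \<le> x powr b" using n0[of "n+n0"] unfolding b_def
            by (intro powr_mono) auto
          thus ?thesis by (simp add: add_increasing)
        next
          case False
          hence "x powr (Re (u (n+n0)) + m) \<le> x powr a" using n0[of "n+n0"] that unfolding a_def
            by (intro powr_mono') auto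
          thus ?thesis by (simp add: add_increasing2)
        qed
        show "norm (indicator {0<..} x *\<^sub>R (of_real (exp_sum c N x) * complex_of_real x powr u (n + n0)))
          \<le> indicator {0<..} x *\<^sub>R ?g x"
        proof (cases "x > 0")
          case True
          have "norm (of_real (exp_sum c N x) * complex_of_real x powr u (n + n0)) 
            \<le> C * (x powr (Re (u (n+n0)) + m) * exp (-x))" by (rule C(2)[OF True])
          also have "\<dots> \<le> C * ((x powr a + x powr b) * exp (-x))"
            using *[OF True] C(1) by (intro mult_left_mono mult_right_mono) auto
          finally show ?thesis using True by (simp add: algebra_simps)
        qed auto
      qed
    qed measurable
    thus "(mellin c N \<circ> u) \<longlonglongrightarrow> mellin c N w"
      unfolding o_def by (rule LIMSEQ_offset)
  qed
qed

text \<open>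
  Integration by parts with the antiderivative \<open>x\<^bsup>w+1\<^esup> / (w + 1)\<close>; the boundary term at \<open>0\<close> disappears
  because the order of vanishing of the exponential sum outweighs the power.
\<close>
lemma mellin_by_parts:
  assumes v: "derivs_vanish c N (Suc m)" and w: "Re w > - real (Suc m) - 1" "w \<noteq> -1"
  shows "(w + 1) * mellin c N w = - mellin (\<lambda>n. - ((real n)\<^sup>2 * c n)) N (w + 1)"
proof -
  let ?c = "\<lambda>n. - ((real n)\<^sup>2 * c n)"
  let ?F = "\<lambda>x::real. of_real (exp_sum c N x) * complex_of_real x powr (w+1)"
  let ?f1 = "\<lambda>x::real. of_real (exp_sum c N x) * complex_of_real x powr w"
  let ?f2 = "\<lambda>x::real. of_real (exp_sum ?c N x) * complex_of_real x powr (w+1)"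
  have i1: "set_integrable lborel {0<..} ?f1" by (rule mellin_integrable[OF v w(1)])
  have i2: "set_integrable lborel {0<..} ?f2"
    by (rule mellin_integrable[OF derivs_vanish_deriv[OF v]]) (use w in auto)
  have ei: "einterval 0 \<infinity> = {0<..}" by (auto simp: einterval_def)
  obtain C where C: "C \<ge> 0"
    "\<And>x w. x > 0 \<Longrightarrow> norm (of_real (exp_sum c N x) * of_real x powr w) \<le> C * (x powr (Re w + Suc m) * exp (-x))"
    using mellin_bound[OF v] by blast
  define r where "r = Re (w+1) + Suc m"
  have r: "r > 0" using w by (simp add: r_def)
  have "(LBINT x=0..\<infinity>. (w+1) * ?f1 x + ?f2 x) = 0 - 0"
  proof (rule interval_integral_FTC_integrable)
    show "0 < (\<infinity>::ereal)" by simp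
    fix x assume "0 < ereal x"
    hence x: "x > 0" by simp
    have "((\<lambda>x. complex_of_real x powr (w+1)) has_vector_derivative (w+1) * of_real x powr w) (at x)"
      using x by (auto intro!: derivative_eq_intros has_vector_derivative_real_field 
          simp: complex_nonpos_Reals_iff powr_diff powr_add field_simps)
    moreover have "((\<lambda>x. complex_of_real (exp_sum c N x)) has_vector_derivative of_real (exp_sum ?c N x)) (at x)"
      by (intro has_vector_derivative_of_real) (use exp_sum_deriv has_real_derivative_iff_has_vector_derivative in blast)
    ultimately show "(?F has_vector_derivative ((w+1) * ?f1 x + ?f2 x)) (at x)"
      using has_vector_derivative_mult by (fastforce simp: algebra_simps)
    show "isCont (\<lambda>x. (w+1) * ?f1 x + ?f2 x) x"
      using x by (intro continuous_intros exp_sum_continuous) auto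
  next
    show "set_integrable lborel (einterval 0 \<infinity>) (\<lambda>x. (w+1) * ?f1 x + ?f2 x)"
      unfolding ei using i1 i2 by (intro set_integral_add set_integrable_mult_right) auto
    have b: "norm (?F x) \<le> C * (x powr r * exp (-x))" if "x > 0" for x
      using C(2)[OF that, of "w+1"] unfolding r_def .
    show "((?F \<circ> real_of_ereal) \<longlongrightarrow> 0) (at_right 0)"
    proof -
      have "(?F \<longlongrightarrow> 0) (at_right 0)"
      proof (rule Lim_null_comparison)
        show "\<forall>\<^sub>F x in at_right 0. norm (?F x) \<le> C * (x powr r * exp (-x))"
          using b by (auto simp: eventually_at_right_field intro: exI[of _ 1])
        show "((\<lambda>x. C * (x powr r * exp (-x))) \<longlongrightarrow> 0) (at_right 0)"
          using r by real_asymp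
      qed
      thus ?thesis unfolding zero_ereal_def ereal_tendsto_simps .
    qed
    show "((?F \<circ> real_of_ereal) \<longlongrightarrow> 0) (at_left \<infinity>)"
    proof -
      have "(?F \<longlongrightarrow> 0) at_top"
      proof (rule Lim_null_comparison)
        show "\<forall>\<^sub>F x in at_top. norm (?F x) \<le> C * (x powr r * exp (-x))"
          using eventually_gt_at_top[of 0] by eventually_elim (rule b)
        show "((\<lambda>x. C * (x powr r * exp (-x))) \<longlongrightarrow> 0) at_top"
          using r by real_asymp
      qed
      thus ?thesis unfolding ereal_tendsto_simps .
    qed
  qed
  also have "(LBINT x=0..\<infinity>. (w+1) * ?f1 x + ?f2 x) = (LINT x:{0<..}|lborel. (w+1) * ?f1 x + ?f2 x)"
    using interval_integral_Ioi[of 0] by (simp add: zero_ereal_def)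
  also have "\<dots> = (w+1) * mellin c N w + mellin ?c N (w+1)"
    unfolding mellin_def using i1 i2 by (subst set_integral_add) auto
  finally show ?thesis by (simp add: add_eq_0_iff)
qed

text \<open>
  For \<open>m = 0\<close> this is the Gamma integral of each term. Each further vanishing derivative allows one more
  integration by parts, which moves \<open>w\<close> to \<open>w + 1\<close>; the factor \<open>w + 1\<close> that appears is absorbed by the
  functional equation of the Gamma function, and the new coefficients \<open>- n\<^sup>2 c(n)\<close> compensate the shift
  in the exponent of \<open>n\<close>.
\<close>
lemma mellin_formula:
  assumes "derivs_vanish c N m" "Re w > - real m - 1" "w + 1 \<notin> \<int>\<^sub>\<le>\<^sub>0"
  shows "mellin c N w = Gamma (w + 1) * (\<Sum>n=1..N. of_real (c n) / of_nat n powr (2*w+2))"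
  using assms
proof (induction m arbitrary: c w)
  case 0
  have pw: "of_real ((real n)\<^sup>2) powr (w+1) = of_nat n powr (2*w+2)" if "n \<ge> 1" for n
  proof -
    have "of_real ((real n)\<^sup>2) powr (w+1) = (complex_of_real (real n) * of_real (real n)) powr (w+1)"
      by (simp add: power2_eq_square)
    also have "\<dots> = of_nat n powr (w+1) * of_nat n powr (w+1)" by (subst powr_times_real) auto
    also have "\<dots> = of_nat n powr (2*w+2)" by (simp flip: powr_add add: algebra_simps)
    finally show ?thesis .
  qed
  let ?k = "\<lambda>n t. of_real (exp (- ((real n)\<^sup>2*t))) * complex_of_real t powr (w+1-1)"
  have i: "set_integrable lborel {0<..} (?k n)" if "n \<ge> 1" for n
    using 0 that by (intro Gamma_set_integral) auto
  have "mellin c N w = (LINT t:{0<..}|lborel. (\<Sum>n=1..N. of_real (c n) * ?k n t))"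
    unfolding mellin_def exp_sum_def by (simp add: sum_distrib_right mult.assoc)
  also have "\<dots> = (\<Sum>n=1..N. (LINT t:{0<..}|lborel. of_real (c n) * ?k n t))"
    unfolding set_lebesgue_integral_def scaleR_sum_right
  proof (intro Bochner_Integration.integral_sum)
    fix n assume n: "n \<in> {1..N}"
    have "set_integrable lborel {0<..} (\<lambda>t. of_real (c n) * ?k n t)"
      using n by (intro set_integrable_mult_right i) auto
    thus "integrable lborel (\<lambda>t. indicator {0<..} t *\<^sub>R (of_real (c n) * ?k n t))"
      unfolding set_integrable_def .
  qed
  also have "\<dots> = (\<Sum>n=1..N. of_real (c n) * (Gamma (w+1) / of_nat n powr (2*w+2)))"
  proof (intro sum.cong refl)
    fix n assume n: "n \<in> {1..N}"
    have "(LINT t:{0<..}|lborel. of_real (c n) * ?k n t) = of_real (c n) * (LINT t:{0<..}|lborel. ?k n t)" by simp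
    also have "(LINT t:{0<..}|lborel. ?k n t) = Gamma (w+1) / of_real ((real n)\<^sup>2) powr (w+1)"
      using 0 n by (intro Gamma_set_integral) auto
    finally show "(LINT t:{0<..}|lborel. of_real (c n) * ?k n t) = of_real (c n) * (Gamma (w+1) / of_nat n powr (2*w+2))"
      using n by (subst (asm) pw) auto
  qed
  finally show ?case by (simp add: sum_distrib_left mult_ac)
next
  case (Suc m)
  let ?c = "\<lambda>n. - ((real n)\<^sup>2 * c n)"
  have nz: "w + 1 \<noteq> 0" using Suc.prems(3) by auto
  have nz2: "w + 1 + 1 \<notin> \<int>\<^sub>\<le>\<^sub>0"
  proof
    assume "w + 1 + 1 \<in> \<int>\<^sub>\<le>\<^sub>0"
    hence "(w + 1 + 1) - 1 \<in> \<int>\<^sub>\<le>\<^sub>0" by (rule nonpos_Ints_diff_Nats) auto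
    thus False using Suc.prems(3) by (simp add: add.commute)
  qed
  have "(w + 1) * mellin c N w = - mellin ?c N (w + 1)"
    using nz by (intro mellin_by_parts[OF Suc.prems(1,2)]) (auto simp: add_eq_0_iff2)
  also have "mellin ?c N (w + 1) = Gamma (w + 1 + 1) * (\<Sum>n=1..N. of_real (?c n) / of_nat n powr (2*(w+1)+2))"
    using Suc.prems nz2 by (intro Suc.IH derivs_vanish_deriv) auto
  also have "(\<Sum>n=1..N. of_real (?c n) / of_nat n powr (2*(w+1)+2)) = - (\<Sum>n=1..N. of_real (c n) / of_nat n powr (2*w+2))"
    unfolding sum_negf[symmetric]
  proof (intro sum.cong refl)
    fix n assume "n \<in> {1..N}"
    hence "of_nat n powr (2*(w+1)+2) = of_nat n powr (2*w+2) * (of_nat n :: complex)^2"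
      by (simp add: powr_add power2_eq_square algebra_simps power4_eq_xxxx)
    thus "of_real (?c n) / of_nat n powr (2*(w+1)+2) = - (of_real (c n) / of_nat n powr (2*w+2))"
      using \<open>n \<in> {1..N}\<close> by (simp add: field_simps)
  qed
  also have "Gamma (w + 1 + 1) = (w + 1) * Gamma (w + 1)"
    using Suc.prems(3) by (intro Gamma_plus1) 
  finally have "(w + 1) * mellin c N w = (w + 1) * (Gamma (w + 1) * (\<Sum>n=1..N. of_real (c n) / of_nat n powr (2*w+2)))"
    by (simp only: mult_minus_left mult_minus_right minus_minus mult.assoc)
  thus ?case using nz mult_left_cancel by blast
qed

section \<open>The distribution of the weighted sum of exponential variables\<close>

definition hypo_coeff :: "nat \<Rightarrow> nat \<Rightarrow> real" where
  "hypo_coeff N n = - 2 * a_coeff n N * (real n)\<^sup>2"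

text \<open>
  The hypoexponential density with rates \<open>1\<^sup>2, 2\<^sup>2, \<dots>, N\<^sup>2\<close>. Its coefficients are the residues in the partial
  fractions of \<open>\<Prod>n\<le>N. n\<^sup>2 / (n\<^sup>2 + t)\<close>, which is the Laplace transform of \<open>S\<^sub>N\<close>.
\<close>
definition hypo_density :: "nat \<Rightarrow> real \<Rightarrow> real" where
  "hypo_density N x = (if x < 0 then 0 else exp_sum (hypo_coeff N) N x)"

lemma hypo_density_measurable [measurable]: "hypo_density N \<in> borel_measurable borel"
  unfolding hypo_density_def by measurable

lemma derivs_vanish_hypo_coeff: "derivs_vanish (hypo_coeff N) N (N - 1)"
  unfolding derivs_vanish_def
proof (intro allI impI)
  fix j assume "j < N - 1"
  hence "power_sum (Suc j) N = 0" by (intro power_sum_eq_0) auto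
  moreover have "(\<Sum>n=1..N. hypo_coeff N n * real n ^ (2*j)) = - 2 * power_sum (Suc j) N"
    unfolding power_sum_def sum_distrib_left hypo_coeff_def
    by (intro sum.cong) (auto simp: power2_eq_square)
  ultimately show "(\<Sum>n=1..N. hypo_coeff N n * real n ^ (2*j)) = 0" by simp
qed

text \<open>
  The coefficient recursion, read as a differential equation.
\<close>
lemma exp_sum_hypo_coeff_deriv:
  "(exp_sum (hypo_coeff (Suc N)) (Suc N) has_real_derivative
      (real (Suc N))\<^sup>2 * (exp_sum (hypo_coeff N) N x - exp_sum (hypo_coeff (Suc N)) (Suc N) x)) (at x)"
proof -
  let ?L = "(real (Suc N))\<^sup>2" and ?E = "\<lambda>n. exp (- ((real n)\<^sup>2 * x))"
  have termwise: "- (q * (- 2 * a * q)) * e + L * (- 2 * a * q * e) = - 2 * q * (a * (L - q)) * e" for q a L e :: real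
    by (simp add: algebra_simps)
  have "exp_sum (\<lambda>n. - ((real n)\<^sup>2 * hypo_coeff (Suc N) n)) (Suc N) x + ?L * exp_sum (hypo_coeff (Suc N)) (Suc N) x
    = (\<Sum>n=1..Suc N. - 2 * (real n)\<^sup>2 * (a_coeff n (Suc N) * (?L - (real n)\<^sup>2)) * ?E n)"
    unfolding exp_sum_def sum_distrib_left sum.distrib[symmetric] hypo_coeff_def
    by (intro sum.cong refl) (rule termwise)
  also have "\<dots> = (\<Sum>n=1..N. - 2 * (real n)\<^sup>2 * (a_coeff n (Suc N) * (?L - (real n)\<^sup>2)) * ?E n)"
    by simp
  also have "\<dots> = (\<Sum>n=1..N. - 2 * (real n)\<^sup>2 * (?L * a_coeff n N) * ?E n)"
    by (intro sum.cong refl) (subst a_coeff_Suc, auto)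
  also have "\<dots> = ?L * exp_sum (hypo_coeff N) N x"
    unfolding exp_sum_def sum_distrib_left hypo_coeff_def by (intro sum.cong refl) (simp only: algebra_simps)
  finally have "exp_sum (\<lambda>n. - ((real n)\<^sup>2 * hypo_coeff (Suc N) n)) (Suc N) x
     = ?L * (exp_sum (hypo_coeff N) N x - exp_sum (hypo_coeff (Suc N)) (Suc N) x)"
    by (simp add: right_diff_distrib)
  thus ?thesis using exp_sum_deriv[of "hypo_coeff (Suc N)" "Suc N" x UNIV] by simp
qed

lemma exp_sum_hypo_coeff_0: "N \<ge> 1 \<Longrightarrow> exp_sum (hypo_coeff (Suc N)) (Suc N) 0 = 0"
  using derivs_vanish_hypo_coeff[of "Suc N"] by (auto simp: derivs_vanish_def exp_sum_def)

lemma hypo_density_1: "hypo_density 1 = exponential_density 1"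
proof -
  have "a_coeff 1 1 = - 1/2" by (simp add: a_coeff_def)
  thus ?thesis by (auto simp: fun_eq_iff hypo_density_def exp_sum_def hypo_coeff_def exponential_density_def)
qed

text \<open>
  The same equation after multiplication by an integrating factor. Since the right-hand side is the
  integrand of the convolution with an exponential density, it yields both the positivity of the densities
  and the value of the convolution.
\<close>
lemma exp_integrating_factor_deriv:
  "((\<lambda>y. exp (- ((real (Suc N))\<^sup>2 * (x - y))) * exp_sum (hypo_coeff (Suc N)) (Suc N) y) has_real_derivative
      (real (Suc N))\<^sup>2 * exp (- ((real (Suc N))\<^sup>2 * (x - y))) * exp_sum (hypo_coeff N) N y) (at y)"
  by (rule derivative_eq_intros exp_sum_hypo_coeff_deriv refl | simp only:)+
     (simp add: algebra_simps)

lemma hypo_density_nonneg: "N \<ge> 1 \<Longrightarrow> hypo_density N x \<ge> 0"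
proof (induction N arbitrary: x rule: dec_induct)
  case base
  show ?case using hypo_density_1 by (simp add: exponential_density_def)
next
  case (step N)
  show ?case
  proof (cases "x < 0")
    case False
    let ?F = "\<lambda>y. exp (- ((real (Suc N))\<^sup>2 * (x - y))) * exp_sum (hypo_coeff (Suc N)) (Suc N) y"
    have "?F 0 \<le> ?F x"
    proof (rule DERIV_nonneg_imp_nondecreasing[of 0 x ?F])
      fix y assume y: "0 \<le> y" "y \<le> x"
      have "exp_sum (hypo_coeff N) N y \<ge> 0" using step.IH[of y] y by (simp add: hypo_density_def)
      thus "\<exists>d. (?F has_real_derivative d) (at y) \<and> 0 \<le> d"
        by (intro exI[of _ "(real (Suc N))\<^sup>2 * exp (- ((real (Suc N))\<^sup>2 * (x - y))) * exp_sum (hypo_coeff N) N y"]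
            conjI exp_integrating_factor_deriv) auto
    qed (use False in auto)
    thus ?thesis using False step.hyps by (simp add: exp_sum_hypo_coeff_0 hypo_density_def)
  qed (simp add: hypo_density_def)
qed

lemma hypo_density_convolution:
  assumes "N \<ge> 1"
  shows "(\<integral>\<^sup>+y. ennreal (exponential_density ((real (Suc N))\<^sup>2) (x - y)) * ennreal (hypo_density N y) \<partial>lborel)
      = ennreal (hypo_density (Suc N) x)"
proof (cases "x < 0")
  case True
  hence zero: "ennreal (exponential_density ((real (Suc N))\<^sup>2) (x - y)) * ennreal (hypo_density N y) = 0" for y
    by (auto simp: exponential_density_def hypo_density_def)
  show ?thesis unfolding zero using True by (simp add: hypo_density_def)
next
  case False
  let ?L = "(real (Suc N))\<^sup>2"
  let ?F = "\<lambda>y. exp (- (?L * (x - y))) * exp_sum (hypo_coeff (Suc N)) (Suc N) y"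
  let ?f = "\<lambda>y. ?L * exp (- (?L * (x - y))) * exp_sum (hypo_coeff N) N y"
  have "(\<integral>\<^sup>+y. ennreal (exponential_density ?L (x - y)) * ennreal (hypo_density N y) \<partial>lborel)
     = (\<integral>\<^sup>+y. ennreal (?f y) * indicator {0..x} y \<partial>lborel)"
  proof (intro nn_integral_cong)
    fix y :: real
    show "ennreal (exponential_density ?L (x - y)) * ennreal (hypo_density N y) = ennreal (?f y) * indicator {0..x} y"
    proof (cases "y \<in> {0..x}")
      case True
      hence "exponential_density ?L (x - y) = ?L * exp (- (?L * (x - y)))"
        by (simp add: exponential_density_def algebra_simps)
      moreover have "hypo_density N y = exp_sum (hypo_coeff N) N y"
        using True by (simp add: hypo_density_def)
      ultimately show ?thesis using True by (simp add: ennreal_mult')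
    qed (auto simp: exponential_density_def hypo_density_def)
  qed
  also have "\<dots> = ?F x - ?F 0"
  proof (rule nn_integral_FTC_Icc)
    fix y assume y: "y \<in> {0..x}"
    show "(?F has_real_derivative ?f y) (at y)" by (rule exp_integrating_factor_deriv)
    show "0 \<le> ?f y" using hypo_density_nonneg[OF assms, of y] y by (simp add: hypo_density_def)
  qed (use False in auto)
  finally show ?thesis using False assms by (simp add: exp_sum_hypo_coeff_0 hypo_density_def)
qed

text \<open>
  Adding an independent summand convolves the densities.
\<close>
lemma (in prob_space) distributed_hypo_density:
  assumes "N \<ge> 1" "indep_vars (\<lambda>_. borel) \<epsilon> {1..N}"
    "\<And>n. n \<in> {1..N} \<Longrightarrow> distributed M lborel (\<epsilon> n) (exponential_density 1)"
  shows "distributed M lborel (\<lambda>\<omega>. \<Sum>n=1..N. \<epsilon> n \<omega> / (real n)\<^sup>2) (hypo_density N)"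
  using assms
proof (induction N rule: dec_induct)
  case base
  thus ?case using hypo_density_1 by simp
next
  case (step N)
  let ?X = "\<lambda>n \<omega>. \<epsilon> n \<omega> / (real n)\<^sup>2"
  have ins: "{1..Suc N} = insert (Suc N) {1..N}" by auto
  have IH: "distributed M lborel (\<lambda>\<omega>. \<Sum>n=1..N. ?X n \<omega>) (hypo_density N)"
    using step.prems by (intro step.IH) (auto intro: indep_vars_subset)
  have "indep_vars (\<lambda>_. borel) ?X (insert (Suc N) {1..N})"
    unfolding ins[symmetric] using step.prems(1) by (rule indep_vars_compose2) auto
  hence indep: "indep_var borel (?X (Suc N)) borel (\<lambda>\<omega>. \<Sum>n=1..N. ?X n \<omega>)"
    by (intro indep_vars_sum) auto
  let ?c = "1 / (real (Suc N))\<^sup>2"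
  have "distributed M lborel (\<lambda>\<omega>. 0 + ?c * \<epsilon> (Suc N) \<omega>)
      (\<lambda>x. ennreal (exponential_density 1 ((x - 0) / ?c)) / ennreal \<bar>?c\<bar>)"
    using step.prems(2)[of "Suc N"] by (intro distributed_affine) (auto simp del: of_nat_Suc)
  also have "(\<lambda>x. ennreal (exponential_density 1 ((x - 0) / ?c)) / ennreal \<bar>?c\<bar>)
      = (\<lambda>x. ennreal (exponential_density ((real (Suc N))\<^sup>2) x))"
  proof
    fix x :: real
    have "0 < (real (Suc N))\<^sup>2" by (simp del: of_nat_Suc)
    thus "ennreal (exponential_density 1 ((x - 0) / ?c)) / ennreal \<bar>?c\<bar>
      = ennreal (exponential_density ((real (Suc N))\<^sup>2) x)"
      by (subst divide_ennreal) (auto simp: exponential_density_def mult_less_0_iff mult.commute simp del: of_nat_Suc)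
  qed
  finally have E: "distributed M lborel (?X (Suc N)) (\<lambda>x. ennreal (exponential_density ((real (Suc N))\<^sup>2) x))"
    by simp
  have "distributed M lborel (\<lambda>\<omega>. ?X (Suc N) \<omega> + (\<Sum>n=1..N. ?X n \<omega>))
    (\<lambda>x. \<integral>\<^sup>+y. ennreal (exponential_density ((real (Suc N))\<^sup>2) (x - y)) * ennreal (hypo_density N y) \<partial>lborel)"
    by (rule distributed_convolution[OF indep E IH])
  also have "(\<lambda>\<omega>. ?X (Suc N) \<omega> + (\<Sum>n=1..N. ?X n \<omega>)) = (\<lambda>\<omega>. \<Sum>n=1..Suc N. ?X n \<omega>)"
    by (simp add: add.commute)
  finally show ?case using hypo_density_convolution[OF step.hyps(1)] by simp
qed

section \<open>Complex moments\<close>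

definition hypo_moment :: "nat \<Rightarrow> complex \<Rightarrow> complex" where
  "hypo_moment N w = mellin (hypo_coeff N) N w"

lemma hypo_moment_integrable:
  assumes "N \<ge> 1" "Re w > - real N"
  shows "integrable lborel (\<lambda>x. hypo_density N x *\<^sub>R (of_real x powr w))"
proof -
  have "set_integrable lborel {0<..} (\<lambda>x. of_real (exp_sum (hypo_coeff N) N x) * of_real x powr w)"
    using assms by (intro mellin_integrable[OF derivs_vanish_hypo_coeff]) auto
  also have "?this \<longleftrightarrow> ?thesis" unfolding set_integrable_def
    by (intro Bochner_Integration.integrable_cong) 
       (auto simp: indicator_def hypo_density_def scaleR_conv_of_real)
  finally show ?thesis .
qed

lemma hypo_moment_eq: "hypo_moment N w = (\<integral>x. hypo_density N x *\<^sub>R (of_real x powr w) \<partial>lborel)"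
  unfolding hypo_moment_def mellin_def set_lebesgue_integral_def
  by (intro Bochner_Integration.integral_cong) 
     (auto simp: indicator_def hypo_density_def scaleR_conv_of_real)

lemma isCont_hypo_moment: "N \<ge> 1 \<Longrightarrow> Re w > - real N \<Longrightarrow> isCont (hypo_moment N) w"
  unfolding hypo_moment_def[abs_def] by (rule mellin_continuous[OF derivs_vanish_hypo_coeff]) auto

lemma hypo_moment_dirichlet_sum:
  assumes "N \<ge> 1" "Re w > - real N" "w + 1 \<notin> \<int>\<^sub>\<le>\<^sub>0"
  shows "hypo_moment N w = - 2 * Gamma (w + 1) * dirichlet_sum N (2 * w)"
proof -
  have "hypo_moment N w = Gamma (w + 1) * (\<Sum>n=1..N. of_real (hypo_coeff N n) / of_nat n powr (2*w+2))"
    unfolding hypo_moment_def using assms by (intro mellin_formula[OF derivs_vanish_hypo_coeff]) auto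
  also have "(\<Sum>n=1..N. of_real (hypo_coeff N n) / of_nat n powr (2*w+2)) = - 2 * dirichlet_sum N (2 * w)"
    unfolding dirichlet_sum_def sum_distrib_left
    by (intro sum.cong) (auto simp: hypo_coeff_def powr_add)
  finally show ?thesis by simp
qed

text \<open>
  With the reciprocal Gamma function the formula holds on the whole half-plane: at the poles \<open>w = - j\<close>
  of \<open>\<Gamma>(w + 1)\<close>, the left-hand side is the power sum of exponent \<open>2 j\<close> and both sides vanish.
\<close>
lemma dirichlet_sum_hypo_moment:
  assumes "N \<ge> 1" "Re w > - real N"
  shows "dirichlet_sum N (2 * w) = - (1/2) * rGamma (w + 1) * hypo_moment N w"
proof (cases "w + 1 \<in> \<int>\<^sub>\<le>\<^sub>0")
  case False
  thus ?thesis using hypo_moment_dirichlet_sum[OF assms False] 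
    by (simp add: rGamma_inverse_Gamma Gamma_eq_zero_iff)
next
  case True
  then obtain k where k: "w + 1 = - of_nat k" by (auto elim: nonpos_Ints_cases')
  have "w = (w + 1) - 1" by simp
  hence w: "w = - of_nat (Suc k)" by (simp only: k) simp
  have "dirichlet_sum N (2 * w) = of_real (power_sum (Suc k) N)"
    unfolding w using dirichlet_sum_neg_even[of N "Suc k"] by simp
  also have "\<dots> = 0" using assms unfolding w by (subst power_sum_eq_0) auto
  finally show ?thesis using True by (simp add: rGamma_eq_zero_iff)
qed

lemma eventually_not_nonpos_Ints: "\<forall>\<^sub>F z in at (w::complex). z \<notin> \<int>\<^sub>\<le>\<^sub>0"
proof -
  have "closed (\<int>\<^sub>\<le>\<^sub>0 - {w})"
  proof (rule discrete_imp_closed[of 1])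
    show "\<forall>x\<in>\<int>\<^sub>\<le>\<^sub>0 - {w}. \<forall>y\<in>\<int>\<^sub>\<le>\<^sub>0 - {w}. dist y x < 1 \<longrightarrow> y = x"
    proof (intro ballI impI)
      fix x y assume "x \<in> \<int>\<^sub>\<le>\<^sub>0 - {w}" "y \<in> \<int>\<^sub>\<le>\<^sub>0 - {w}" and d: "dist y x < 1"
      hence "x \<in> \<int>" "y \<in> \<int>" using nonpos_Ints_Int by blast+
      then obtain a b where ab: "x = of_int a" "y = of_int b" by (elim Ints_cases)
      have "dist y x = norm (of_int (b - a) :: complex)" unfolding ab dist_norm by simp
      also have "\<dots> = \<bar>real_of_int (b - a)\<bar>" by (rule norm_of_int)
      finally have "real_of_int \<bar>b - a\<bar> < 1" using d by simp
      hence "b = a" by simp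
      thus "y = x" unfolding ab by simp
    qed
  qed simp
  hence "open (- (\<int>\<^sub>\<le>\<^sub>0 - {w}))" by (rule open_Compl)
  hence "\<forall>\<^sub>F z in nhds w. z \<in> - (\<int>\<^sub>\<le>\<^sub>0 - {w})" by (rule eventually_nhds_in_open) auto
  thus ?thesis unfolding eventually_at_filter by eventually_elim auto
qed

text \<open>
  The closed formula and the moment agree near \<open>s\<close> except possibly at \<open>s\<close>, and the moment is continuous, so
  its value is the limit that \<open>remove_sings\<close> takes.
\<close>
lemma moment_formula_eq:
  assumes N: "N \<ge> 1" and s: "Re s > - 2 * real N"
  shows "moment_formula N s = of_real (2 / pi\<^sup>2) powr (s / 2) * hypo_moment N (s / 2)"
  unfolding moment_formula_def
proof (rule remove_sings_eqI)
  let ?f = "\<lambda>z. of_real (2 / pi\<^sup>2) powr (z / 2) * hypo_moment N (z / 2)"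
  let ?g = "\<lambda>z. - z * (2 powr (z / 2) / of_real pi powr z) * Gamma (z / 2) * dirichlet_sum N z"
  have "isCont (hypo_moment N) (s / 2)" using N s by (intro isCont_hypo_moment) auto
  hence "isCont (\<lambda>z. hypo_moment N (z / 2)) s"
    using continuous_at_compose[of s "\<lambda>z. z / 2" "hypo_moment N"] by (simp add: o_def)
  hence "isCont ?f s" by (intro continuous_intros) auto
  hence "?f \<midarrow>s\<rightarrow> ?f s" by (simp add: isCont_def)
  moreover have "\<forall>\<^sub>F z in at s. ?f z = ?g z"
  proof -
    have "filterlim (\<lambda>z. z / 2) (at (s / 2)) (at s)"
      by (auto simp: filterlim_at eventually_at_filter intro!: tendsto_intros)
    hence "\<forall>\<^sub>F z in at s. z / 2 \<notin> \<int>\<^sub>\<le>\<^sub>0"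
      using eventually_not_nonpos_Ints[of "s / 2"] by (auto simp: filterlim_iff)
    moreover have "\<forall>\<^sub>F z in at s. z \<in> {z. Re z > - 2 * real N}"
      using s by (intro eventually_at_in_open' open_halfspace_Re_gt) auto
    ultimately show ?thesis
    proof eventually_elim
      case (elim z)
      have "z / 2 + 1 \<notin> \<int>\<^sub>\<le>\<^sub>0"
      proof
        assume "z / 2 + 1 \<in> \<int>\<^sub>\<le>\<^sub>0"
        hence "(z / 2 + 1) - 1 \<in> \<int>\<^sub>\<le>\<^sub>0" by (rule nonpos_Ints_diff_Nats) auto
        thus False using elim by simp
      qed
      hence "hypo_moment N (z / 2) = - 2 * Gamma (z / 2 + 1) * dirichlet_sum N z"
        using hypo_moment_dirichlet_sum[of N "z / 2"] N elim by simp
      also have "Gamma (z / 2 + 1) = z / 2 * Gamma (z / 2)" using elim by (simp add: Gamma_plus1)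
      finally have "hypo_moment N (z / 2) = - z * Gamma (z / 2) * dirichlet_sum N z" by simp
      moreover have "of_real (2 / pi\<^sup>2) powr (z / 2) = 2 powr (z / 2) / of_real pi powr z"
      proof -
        have pi2: "(complex_of_real pi * of_real pi) powr (z / 2) = of_real pi powr (z / 2) * of_real pi powr (z / 2)"
          by (rule powr_times_real) auto
        have "complex_of_real 2 powr (z / 2) = (of_real (2 / pi\<^sup>2) * (of_real pi * of_real pi)) powr (z / 2)"
          by (simp add: power2_eq_square)
        also have "\<dots> = of_real (2 / pi\<^sup>2) powr (z / 2) * (of_real pi powr (z / 2) * of_real pi powr (z / 2))"
          unfolding pi2[symmetric] by (rule powr_times_real) auto
        also have "of_real pi powr (z / 2) * of_real pi powr (z / 2) = complex_of_real pi powr z"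
          by (simp flip: powr_add)
        finally show ?thesis by (simp add: field_simps)
      qed
      ultimately show ?case by simp
    qed
  qed
  ultimately show "?g \<midarrow>s\<rightarrow> ?f s" by (rule Lim_transform_eventually)
qed

lemma (in prob_space) hypo_sum_expectation:
  assumes N: "N \<ge> 1" and s: "Re s > - 2 * real N"
    and S: "distributed M lborel S (hypo_density N)"
  shows "integrable M (\<lambda>\<omega>. complex_of_real (2 / pi\<^sup>2 * S \<omega>) powr (s / 2))"
    and "expectation (\<lambda>\<omega>. complex_of_real (2 / pi\<^sup>2 * S \<omega>) powr (s / 2)) = moment_formula N s"
proof -
  let ?g = "\<lambda>x. complex_of_real (2 / pi\<^sup>2 * x) powr (s / 2)"
  let ?c = "complex_of_real (2 / pi\<^sup>2) powr (s / 2)"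
  have Sm [measurable]: "S \<in> borel_measurable M" using S by (simp add: distributed_def)
  have nn: "AE x in lborel. 0 \<le> hypo_density N x" using hypo_density_nonneg[OF N] by simp
  have distr: "distr M lborel S = density lborel (hypo_density N)" using S by (simp add: distributed_def)
  have eq: "hypo_density N x *\<^sub>R ?g x = ?c * (hypo_density N x *\<^sub>R (of_real x powr (s / 2)))" for x
  proof (cases "x < 0")
    case False
    hence "?g x = ?c * of_real x powr (s / 2)"
      by (subst of_real_mult, subst powr_times_real) auto
    thus ?thesis by simp
  qed (simp add: hypo_density_def)
  have "integrable lborel (\<lambda>x. ?c * (hypo_density N x *\<^sub>R (of_real x powr (s / 2))))"
    using N s by (intro integrable_mult_right hypo_moment_integrable) auto
  hence "integrable lborel (\<lambda>x. hypo_density N x *\<^sub>R ?g x)" unfolding eq .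
  hence "integrable (density lborel (hypo_density N)) ?g"
    by (rule integrable_density[THEN iffD2, OF _ _ nn, rotated 2]) measurable
  hence "integrable (distr M lborel S) ?g" by (simp add: distr)
  thus "integrable M (\<lambda>\<omega>. ?g (S \<omega>))" by (subst (asm) integrable_distr_eq) auto
  have "expectation (\<lambda>\<omega>. ?g (S \<omega>)) = integral\<^sup>L (distr M lborel S) ?g"
    by (subst integral_distr) auto
  also have "\<dots> = (\<integral>x. hypo_density N x *\<^sub>R ?g x \<partial>lborel)"
    unfolding distr using nn by (subst integral_density) auto
  also have "\<dots> = ?c * hypo_moment N (s / 2)" unfolding eq hypo_moment_eq by (rule integral_mult_right_zero)
  also have "\<dots> = moment_formula N s" by (rule moment_formula_eq[OF N s, symmetric])
  finally show "expectation (\<lambda>\<omega>. ?g (S \<omega>)) = moment_formula N s" .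
qed

section \<open>The zeta function and the alternating series\<close>

text \<open>
  The difference of \<open>k\<^bsup>-s\<^esup>\<close> and \<open>\<integral> x\<^bsup>-s\<^esup> dx\<close> over \<open>[k, k + 1]\<close>, for \<open>k = n + 1\<close>.
\<close>
definition zeta_term :: "nat \<Rightarrow> complex \<Rightarrow> complex" where
  "zeta_term n s = 1 / of_nat (Suc n) powr s -
     (of_nat (Suc (Suc n)) powr (1 - s) - of_nat (Suc n) powr (1 - s)) / (1 - s)"

lemma unit_segment_of_real:
  "closed_segment (complex_of_real a) (of_real (a+1)) = of_real ` {a..a+1}"
  by (subst closed_segment_of_real) (simp add: closed_segment_eq_real_ivl)

lemma norm_Suc_powr: "norm (of_nat (Suc n) powr s :: complex) = real (Suc n) powr Re s"
  by (subst norm_powr_real_powr) (simp_all del: of_nat_Suc)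

lemma norm_powr_diff_le:
  assumes a: "1 \<le> a" "a \<le> x" "x \<le> a + 1" and s: "Re s > 0"
  shows "norm (of_real a powr (- s) - of_real x powr (- s) :: complex) \<le> norm s * a powr (- Re s - 1)"
proof -
  have "norm (of_real a powr (- s) - of_real x powr (- s) :: complex)
      \<le> (norm s * a powr (- Re s - 1)) * norm (of_real a - of_real x :: complex)"
  proof (rule field_differentiable_bound[where S = "closed_segment (of_real a) (of_real (a+1))"])
    fix z assume "z \<in> closed_segment (complex_of_real a) (of_real (a+1))"
    then obtain t where z: "z = of_real t" and t: "a \<le> t"
      unfolding unit_segment_of_real by auto
    show "((\<lambda>z. z powr (- s)) has_field_derivative (- s) * z powr (- s - 1)) (at z within closed_segment (of_real a) (of_real (a+1)))"
      using a t by (intro has_field_derivative_powr[THEN has_field_derivative_at_within]) (auto simp: z complex_nonpos_Reals_iff)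
    have "norm ((- s) * z powr (- s - 1)) = norm s * t powr (- Re s - 1)"
      using a t by (simp add: z norm_mult norm_powr_real_powr)
    also have "\<dots> \<le> norm s * a powr (- Re s - 1)"
      using a t s by (intro mult_left_mono powr_mono2') auto
    finally show "norm ((- s) * z powr (- s - 1)) \<le> norm s * a powr (- Re s - 1)" .
  next
    show "of_real a \<in> closed_segment (complex_of_real a) (of_real (a+1))"
      "of_real x \<in> closed_segment (complex_of_real a) (of_real (a+1))"
      unfolding unit_segment_of_real using a by auto
  qed simp
  also have "\<dots> \<le> (norm s * a powr (- Re s - 1)) * 1"
    using a by (intro mult_left_mono) (auto simp flip: of_real_diff)
  finally show ?thesis by simp
qed

text \<open>
  The term is the increment over \<open>[k, k + 1]\<close> of a function whose derivative \<open>k\<^bsup>-s\<^esup> - x\<^bsup>-s\<^esup>\<close> is small, being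
  itself the increment of a slowly varying function.
\<close>
lemma norm_zeta_term_le:
  assumes s: "Re s > 0" "s \<noteq> 1"
  shows "norm (zeta_term n s) \<le> norm s * real (Suc n) powr (- Re s - 1)"
proof -
  define a where "a = real (Suc n)"
  have a: "a \<ge> 1" by (simp add: a_def)
  define G where "G = (\<lambda>z::complex. z * of_real a powr (- s) - z powr (1 - s) / (1 - s))"
  have "norm (G (of_real (a+1)) - G (of_real a)) \<le> (norm s * a powr (- Re s - 1)) * norm (of_real (a+1) - of_real a :: complex)"
  proof (rule field_differentiable_bound[where S = "closed_segment (of_real a) (of_real (a+1))"])
    fix z assume "z \<in> closed_segment (complex_of_real a) (of_real (a+1))"
    then obtain t where z: "z = of_real t" and t: "a \<le> t" "t \<le> a + 1"
      unfolding unit_segment_of_real by auto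
    have "(G has_field_derivative of_real a powr (- s) - ((1 - s) * z powr (1 - s - 1)) / (1 - s)) (at z)"
      unfolding G_def using a t s(2)
      by (intro derivative_eq_intros has_field_derivative_powr refl) (auto simp: z complex_nonpos_Reals_iff)
    also have "of_real a powr (- s) - ((1 - s) * z powr (1 - s - 1)) / (1 - s) = of_real a powr (- s) - z powr (- s)"
      using s by simp
    finally show "(G has_field_derivative of_real a powr (- s) - z powr (- s)) (at z within closed_segment (of_real a) (of_real (a+1)))"
      by (rule has_field_derivative_at_within)
    show "norm (of_real a powr (- s) - z powr (- s)) \<le> norm s * a powr (- Re s - 1)"
      unfolding z by (rule norm_powr_diff_le) (use a t s in auto)
  qed auto
  moreover have "G (of_real (a+1)) - G (of_real a) = zeta_term n s"
    by (simp add: G_def zeta_term_def a_def powr_minus divide_inverse algebra_simps)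
  ultimately show ?thesis by (simp add: a_def)
qed

lemma zeta_term_holomorphic: "zeta_term n holomorphic_on - {1}"
  unfolding zeta_term_def by (intro holomorphic_intros) auto

lemma summable_Suc_powr: "a < -1 \<Longrightarrow> summable (\<lambda>n. real (Suc n) powr a)"
  using summable_real_powr_iff[of a] by (subst summable_Suc_iff) auto

text \<open>
  The zeta function for \<open>Re s > 0\<close>: the sum of the integrals subtracted in the terms is \<open>1 / (s - 1)\<close>.
\<close>
definition zeta_right :: "complex \<Rightarrow> complex" where
  "zeta_right s = 1 / (s - 1) + (\<Sum>n. zeta_term n s)"

lemma zeta_right_holomorphic: "zeta_right holomorphic_on {s. Re s > 0} - {1}"
proof -
  let ?S = "{s. Re s > 0} - {1}"
  have op: "open ?S" by (intro open_delete open_halfspace_Re_gt)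
  have "(\<lambda>s. \<Sum>n. zeta_term n s) holomorphic_on ?S"
  proof (rule holomorphic_uniform_sequence[OF op])
    show "(\<lambda>s. \<Sum>i<n. zeta_term i s) holomorphic_on ?S" for n
      by (intro holomorphic_intros holomorphic_on_subset[OF zeta_term_holomorphic]) auto
    fix x assume x: "x \<in> ?S"
    then obtain e where e: "e > 0" "cball x e \<subseteq> ?S" using op open_contains_cball by blast
    define d where "d = min e (Re x / 2)"
    have d: "d > 0" "d \<le> e" "d \<le> Re x / 2" using e x by (auto simp: d_def)
    have sub: "cball x d \<subseteq> ?S" using e d by (meson order_trans subset_cball)
    have "uniform_limit (cball x d) (\<lambda>n s. \<Sum>i<n. zeta_term i s) (\<lambda>s. \<Sum>i. zeta_term i s) sequentially"
    proof (rule Weierstrass_m_test)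
      fix n s assume s: "s \<in> cball x d"
      hence s': "Re s > 0" "s \<noteq> 1" using sub by auto
      have "\<bar>Re x - Re s\<bar> \<le> d" using s abs_Re_le_cmod[of "x - s"] by (auto simp: dist_norm)
      hence "Re s \<ge> Re x / 2" using d by auto
      moreover have "norm s \<le> norm x + d" using s norm_triangle_sub[of s x] by (auto simp: dist_norm norm_minus_commute)
      ultimately show "norm (zeta_term n s) \<le> (norm x + d) * real (Suc n) powr (- (Re x / 2) - 1)"
        using d by (intro order_trans[OF norm_zeta_term_le[OF s']] mult_mono powr_mono) auto
    next
      show "summable (\<lambda>n. (norm x + d) * real (Suc n) powr (- (Re x / 2) - 1))"
        using x by (intro summable_mult summable_Suc_powr) auto
    qed
    thus "\<exists>d>0. cball x d \<subseteq> ?S \<and> uniform_limit (cball x d) (\<lambda>n s. \<Sum>i<n. zeta_term i s) (\<lambda>s. \<Sum>i. zeta_term i s) sequentially"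
      using d sub by blast
  qed
  thus ?thesis unfolding zeta_right_def by (intro holomorphic_intros) auto
qed

lemma summable_dirichlet:
  assumes "Re s > 1"
  shows "summable (\<lambda>n. norm (1 / of_nat (Suc n) powr s :: complex))"
proof -
  have "norm (1 / of_nat (Suc n) powr s :: complex) = real (Suc n) powr (- Re s)" for n
    by (simp add: norm_divide norm_inverse norm_Suc_powr powr_minus divide_inverse del: of_nat_Suc)
  thus ?thesis using summable_Suc_powr[of "- Re s"] assms by simp
qed

lemma zeta_right_sums:
  assumes s: "Re s > 1"
  shows "(\<lambda>n. 1 / of_nat (Suc n) powr s) sums zeta_right s"
proof -
  have s1: "s \<noteq> 1" using s by auto
  have "(\<lambda>n. of_nat (Suc n) powr (1 - s) :: complex) \<longlonglongrightarrow> 0"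
  proof (rule tendsto_norm_zero_cancel)
    have "(\<lambda>n. real (Suc n) powr (1 - Re s)) \<longlonglongrightarrow> 0"
      using s by real_asymp
    thus "(\<lambda>n. norm (of_nat (Suc n) powr (1 - s) :: complex)) \<longlonglongrightarrow> 0"
      by (simp add: norm_Suc_powr del: of_nat_Suc)
  qed
  from telescope_sums[OF this]
  have "(\<lambda>n. of_nat (Suc (Suc n)) powr (1 - s) - of_nat (Suc n) powr (1 - s)) sums (0 - 1 :: complex)"
    by simp
  from sums_divide[OF this, of "1 - s"]
  have T: "(\<lambda>n. (of_nat (Suc (Suc n)) powr (1 - s) - of_nat (Suc n) powr (1 - s)) / (1 - s)) sums (1 / (s - 1))"
    using s1 by (simp add: minus_divide_right)
  have "summable (\<lambda>n. 1 / of_nat (Suc n) powr s :: complex)"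
    by (rule summable_norm_cancel[OF summable_dirichlet[OF s]])
  hence Z: "(\<lambda>n. 1 / of_nat (Suc n) powr s) sums (\<Sum>n. 1 / of_nat (Suc n) powr s :: complex)"
    by (rule summable_sums)
  have "(\<Sum>n. zeta_term n s) = (\<Sum>n. 1 / of_nat (Suc n) powr s) - 1 / (s - 1)"
    using sums_unique[OF sums_diff[OF Z T]] by (simp add: zeta_term_def)
  thus ?thesis using Z by (simp add: zeta_right_def)
qed

lemma two_powr_neq_1: "Re s < 1 \<Longrightarrow> 2 powr (1 - s) - 1 \<noteq> (0::complex)"
proof
  assume s: "Re s < 1" and "2 powr (1 - s) - 1 = (0::complex)"
  hence "norm (2 powr (1 - s) :: complex) = 1" by simp
  moreover have "norm (2 powr (1 - s) :: complex) = 2 powr (1 - Re s)"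
    using norm_powr_real_powr[of 2 "1 - s"] by simp
  moreover have "2 powr (1 - Re s) > 2 powr 0" using s by (intro powr_less_mono) auto
  ultimately show False by simp
qed

text \<open>
  An entire \<open>E\<close> that agrees with \<open>(2\<^bsup>1-s\<^esup> - 1) \<zeta>(s)\<close> on \<open>Re s > 1\<close> continues the zeta function as
  \<open>E(s) / (2\<^bsup>1-s\<^esup> - 1)\<close>. The zeros of the denominator all lie on the line \<open>Re s = 1\<close>, so this quotient is
  used for \<open>Re s < 1\<close> and is glued to \<open>zeta_right\<close> along the strip \<open>0 < Re s < 1\<close>.
\<close>
lemma zeta_continuation:
  assumes E: "E holomorphic_on UNIV"
    and E_eq: "\<And>s. Re s > 1 \<Longrightarrow> E s = (2 powr (1 - s) - 1) * zeta_right s"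
  shows "zeta holomorphic_on - {1}"
    and "\<And>s. Re s > 1 \<Longrightarrow> zeta s = zeta_right s"
proof -
  let ?P = "\<lambda>f. f holomorphic_on - {1}
             \<and> (\<forall>s. Re s > 1 \<longrightarrow> (\<lambda>n. 1 / of_nat (Suc n) powr s) sums f s)
             \<and> f (1::complex) = (0::complex)"
  let ?H = "{s. Re s > 1}"
  have H: "open ?H" "?H \<noteq> {}" by (auto intro: open_halfspace_Re_gt exI[of _ 2])
  have rel: "E s = (2 powr (1 - s) - 1) * zeta_right s" if "Re s > 0" "s \<noteq> 1" for s
  proof (rule analytic_continuation_open[of ?H "{s. Re s > 0} - {1}" E "\<lambda>s. (2 powr (1 - s) - 1) * zeta_right s"])
    show "connected ({s. Re s > 0} - {1})"
      by (intro connected_open_delete open_halfspace_Re_gt convex_connected convex_halfspace_Re_gt) auto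
    show "(\<lambda>s. (2 powr (1 - s) - 1) * zeta_right s) holomorphic_on {s. Re s > 0} - {1}"
      by (intro holomorphic_intros zeta_right_holomorphic) auto
  qed (use that H E_eq in \<open>auto intro: open_delete open_halfspace_Re_gt holomorphic_on_subset[OF E]\<close>)
  define f where "f = (\<lambda>s. if s = 1 then 0 else if Re s > 0 then zeta_right s else E s / (2 powr (1 - s) - 1))"
  have "f holomorphic_on ({s. Re s > 0} - {1}) \<union> {s. Re s < 1}"
  proof (rule holomorphic_on_Un)
    show "f holomorphic_on {s. Re s > 0} - {1}"
      by (rule holomorphic_transform[OF zeta_right_holomorphic]) (auto simp: f_def)
    have "(\<lambda>s. E s / (2 powr (1 - s) - 1)) holomorphic_on {s. Re s < 1}"
      using two_powr_neq_1 by (intro holomorphic_intros holomorphic_on_subset[OF E]) auto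
    thus "f holomorphic_on {s. Re s < 1}"
    proof (rule holomorphic_transform)
      fix s assume "s \<in> {s. Re s < 1}"
      thus "E s / (2 powr (1 - s) - 1) = f s"
        using rel[of s] two_powr_neq_1[of s] by (auto simp: f_def)
    qed
  qed (auto intro: open_delete open_halfspace_Re_gt open_halfspace_Re_lt)
  moreover have "- {1} \<subseteq> ({s. Re s > 0} - {1}) \<union> {s::complex. Re s < 1}" by auto
  ultimately have "f holomorphic_on - {1}" by (rule holomorphic_on_subset)
  hence Pf: "?P f" using zeta_right_sums by (auto simp: f_def)
  have "zeta = f"
    unfolding zeta_def
  proof (rule the_equality)
    fix g assume g: "?P g"
    show "g = f"
    proof
      fix s
      show "g s = f s"
      proof (cases "s = 1")
        case False
        show ?thesis
        proof (rule analytic_continuation_open[of ?H "- {1}" g f])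
          show "connected (- {1::complex})" by (intro connected_punctured_universe) auto
          show "g z = f z" if "z \<in> ?H" for z
          proof (rule sums_unique2)
            show "(\<lambda>n. 1 / of_nat (Suc n) powr z) sums g z" using g that by blast
            show "(\<lambda>n. 1 / of_nat (Suc n) powr z) sums f z" using Pf that by blast
          qed
        qed (use False H g Pf in auto)
      qed (use g Pf in auto)
    qed
  qed (rule Pf)
  thus "zeta holomorphic_on - {1}" using Pf by simp
  show "zeta s = zeta_right s" if "Re s > 1" for s
    unfolding \<open>zeta = f\<close> using that by (auto simp: f_def)
qed

text \<open>
  Negating the terms of the zeta series and adding twice those with even \<open>n\<close>, whose sum is \<open>2\<^bsup>-s\<^esup> \<zeta>(s)\<close>,
  gives the alternating series. In the indexing from \<open>0\<close>, even \<open>n\<close> correspond to odd indices.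
\<close>
lemma alternating_dirichlet_sums:
  assumes s: "Re s > 1"
  shows "(\<lambda>n. (-1) ^ Suc n / of_nat (Suc n) powr s) sums ((2 powr (1 - s) - 1) * zeta_right s)"
proof -
  let ?u = "\<lambda>n. 1 / of_nat (Suc n) powr s :: complex"
  let ?v = "\<lambda>n. if odd n then ?u n else 0"
  have U: "?u sums zeta_right s" by (rule zeta_right_sums[OF s])
  have "?v (2 * n + 1) = 2 powr (- s) * ?u n" for n
  proof -
    have "of_nat (Suc (2 * n + 1)) = complex_of_real 2 * complex_of_real (real (Suc n))" by simp
    hence "of_nat (Suc (2 * n + 1)) powr s = complex_of_real 2 powr s * complex_of_real (real (Suc n)) powr s"
      by (simp only:) (subst powr_times_real, auto)
    thus ?thesis by (simp add: powr_minus divide_inverse)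
  qed
  hence "(\<lambda>n. ?v (2 * n + 1)) sums (2 powr (- s) * zeta_right s)"
    using sums_mult[OF U, of "2 powr (- s)"] by simp
  hence "?v sums (2 powr (- s) * zeta_right s)"
    by (subst (asm) sums_mono_reindex[of "\<lambda>n. 2 * n + 1" ?v]) (auto simp: strict_mono_def elim!: oddE)
  from sums_diff[OF sums_mult[OF this, of 2] U]
  have "(\<lambda>n. 2 * ?v n - ?u n) sums (2 * (2 powr (- s) * zeta_right s) - zeta_right s)" .
  also have "(\<lambda>n. 2 * ?v n - ?u n) = (\<lambda>n. (-1) ^ Suc n / of_nat (Suc n) powr s)"
    by (auto simp: fun_eq_iff)
  also have "2 * (2 powr (- s) * zeta_right s) - zeta_right s = (2 powr (1 - s) - 1) * zeta_right s"
    by (simp add: powr_diff powr_minus field_simps)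
  finally show ?thesis .
qed

section \<open>Locally uniform convergence of the Dirichlet polynomials\<close>

lemma hypo_moment_of_real:
  "hypo_moment N (of_real r) = of_real (\<integral>x. hypo_density N x * x powr r \<partial>lborel)"
proof -
  have "hypo_moment N (of_real r) = (\<integral>x. complex_of_real (hypo_density N x * x powr r) \<partial>lborel)"
    unfolding hypo_moment_eq
    by (intro Bochner_Integration.integral_cong) 
       (auto simp: hypo_density_def scaleR_conv_of_real powr_of_real)
  also have "\<dots> = of_real (\<integral>x. hypo_density N x * x powr r \<partial>lborel)"
    by (rule integral_complex_of_real)
  finally show ?thesis .
qed

lemma Re_hypo_moment_nonneg: "N \<ge> 1 \<Longrightarrow> Re (hypo_moment N (of_real r)) \<ge> 0"
  unfolding hypo_moment_of_real using hypo_density_nonneg by (auto intro!: integral_nonneg)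

text \<open>
  Since the density is nonnegative, absolute values can be taken under the integral, and
  \<open>x\<^bsup>Re w\<^esup> \<le> x\<^bsup>-R\<^esup> + x\<^bsup>R\<^esup>\<close>.
\<close>
lemma norm_hypo_moment_le:
  assumes "N \<ge> 1" "\<bar>Re w\<bar> \<le> R" "R < real N"
  shows "norm (hypo_moment N w) \<le> Re (hypo_moment N (of_real (-R))) + Re (hypo_moment N (of_real R))"
proof -
  have int: "integrable lborel (\<lambda>x. hypo_density N x * x powr r)" if "r > - real N" for r
  proof -
    have "integrable lborel (\<lambda>x. norm (hypo_density N x *\<^sub>R (complex_of_real x powr of_real r)))"
      using hypo_moment_integrable[OF assms(1), of "of_real r"] that by (intro integrable_norm) auto
    also have "(\<lambda>x. norm (hypo_density N x *\<^sub>R (complex_of_real x powr of_real r))) = (\<lambda>x. hypo_density N x * x powr r)"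
    proof
      fix x
      show "norm (hypo_density N x *\<^sub>R (complex_of_real x powr of_real r)) = hypo_density N x * x powr r"
        using hypo_density_nonneg[OF assms(1), of x]
        by (cases "x < 0") (auto simp: hypo_density_def norm_powr_real_powr)
    qed
    finally show ?thesis .
  qed
  have R: "R \<ge> 0" using assms by linarith
  have "norm (hypo_moment N w) \<le> (\<integral>x. norm (hypo_density N x *\<^sub>R (complex_of_real x powr w)) \<partial>lborel)"
    unfolding hypo_moment_eq by (rule integral_norm_bound)
  also have "\<dots> \<le> (\<integral>x. hypo_density N x * x powr (-R) + hypo_density N x * x powr R \<partial>lborel)"
  proof (rule integral_mono)
    show "integrable lborel (\<lambda>x. norm (hypo_density N x *\<^sub>R (complex_of_real x powr w)))"
      using assms by (intro integrable_norm hypo_moment_integrable) auto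
    show "integrable lborel (\<lambda>x. hypo_density N x * x powr (-R) + hypo_density N x * x powr R)"
      using assms R by (intro Bochner_Integration.integrable_add int) auto
    fix x :: real
    have nn: "hypo_density N x \<ge> 0" by (rule hypo_density_nonneg[OF assms(1)])
    show "norm (hypo_density N x *\<^sub>R (complex_of_real x powr w)) \<le> hypo_density N x * x powr (-R) + hypo_density N x * x powr R"
    proof (cases "x > 0")
      case False
      thus ?thesis using nn by (cases "x = 0") (auto simp: hypo_density_def)
    next
      case True
      have "x powr Re w \<le> x powr (-R) + x powr R"
      proof (cases "x \<ge> 1")
        case True
        hence "x powr Re w \<le> x powr R" using assms by (intro powr_mono) auto
        thus ?thesis by (simp add: add_increasing)
      next
        case False
        hence "x powr Re w \<le> x powr (-R)" using assms \<open>x > 0\<close> by (intro powr_mono') auto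
        thus ?thesis by (simp add: add_increasing2)
      qed
      hence "hypo_density N x * x powr Re w \<le> hypo_density N x * (x powr (-R) + x powr R)"
        using nn by (rule mult_left_mono)
      thus ?thesis using True nn by (simp add: norm_powr_real_powr distrib_left)
    qed
  qed
  also have "\<dots> = Re (hypo_moment N (of_real (-R))) + Re (hypo_moment N (of_real R))"
    unfolding hypo_moment_of_real using assms R
    by (subst Bochner_Integration.integral_add) (auto intro!: int)
  finally show ?thesis .
qed

text \<open>
  The recursion of the Dirichlet polynomials, transported to moments; the factor \<open>w\<close> comes from
  \<open>\<Gamma>(w + 1) = w \<Gamma>(w)\<close>.
\<close>
lemma hypo_moment_Suc:
  assumes "N \<ge> 1" "Re w > - real N" "w \<notin> \<int>"
  shows "hypo_moment (Suc N) w = hypo_moment N w + w / of_nat (Suc N) ^ 2 * hypo_moment (Suc N) (w - 1)"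
proof -
  have w: "w + 1 \<notin> \<int>\<^sub>\<le>\<^sub>0" "w \<notin> \<int>\<^sub>\<le>\<^sub>0"
    using assms(3) nonpos_Ints_Int Ints_diff[of "w + 1" 1] by auto
  have "hypo_moment (Suc N) w = - 2 * Gamma (w + 1) * dirichlet_sum (Suc N) (2 * w)"
    using assms w by (intro hypo_moment_dirichlet_sum) auto
  also have "dirichlet_sum (Suc N) (2 * w) = dirichlet_sum N (2 * w) + dirichlet_sum (Suc N) (2 * w - 2) / of_nat (Suc N) ^ 2"
    by (rule dirichlet_sum_Suc)
  also have "- 2 * Gamma (w + 1) * \<dots> = - 2 * Gamma (w + 1) * dirichlet_sum N (2 * w)
     + w / of_nat (Suc N) ^ 2 * (- 2 * Gamma w * dirichlet_sum (Suc N) (2 * w - 2))"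
    using w by (simp add: Gamma_plus1 ring_distribs)
  also have "- 2 * Gamma (w + 1) * dirichlet_sum N (2 * w) = hypo_moment N w"
    using assms w by (intro hypo_moment_dirichlet_sum[symmetric]) auto
  also have "- 2 * Gamma w * dirichlet_sum (Suc N) (2 * w - 2) = hypo_moment (Suc N) (w - 1)"
    using hypo_moment_dirichlet_sum[of "Suc N" "w - 1"] assms w by (simp add: algebra_simps)
  finally show ?thesis .
qed

text \<open>
  The correction term in the recursion is \<open>- R / (N + 1)\<^sup>2\<close> times a nonnegative moment.
\<close>
lemma hypo_moment_negative_antimono:
  assumes "N \<ge> 1" "0 < R" "R < real N" "R \<notin> \<int>"
  shows "Re (hypo_moment (Suc N) (of_real (-R))) \<le> Re (hypo_moment N (of_real (-R)))"
proof -
  have notint: "complex_of_real (-R) \<notin> \<int>"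
  proof
    assume "complex_of_real (-R) \<in> \<int>"
    then obtain k where "complex_of_real (-R) = of_int k" by (elim Ints_cases)
    hence "complex_of_real (-R) = complex_of_real (of_int k)" by simp
    hence "-R = of_int k" by (simp only: of_real_eq_iff)
    hence "R = of_int (-k)" by simp
    thus False using assms(4) by (metis Ints_of_int)
  qed
  have "hypo_moment (Suc N) (of_real (-R)) = hypo_moment N (of_real (-R))
      + of_real (-R) / of_nat (Suc N) ^ 2 * hypo_moment (Suc N) (of_real (-R) - 1)"
    using assms notint by (intro hypo_moment_Suc) auto
  also have "of_real (-R) / of_nat (Suc N) ^ 2 = complex_of_real (- R / real (Suc N) ^ 2)" by simp
  also have "of_real (-R) - 1 = complex_of_real (-R-1)" by simp
  finally have "Re (hypo_moment (Suc N) (of_real (-R))) = Re (hypo_moment N (of_real (-R)))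
      + (- R / real (Suc N) ^ 2) * Re (hypo_moment (Suc N) (of_real (-R-1)))"
    by (simp only: plus_complex.sel Re_complex_of_real times_complex.sel Im_complex_of_real)
  moreover have "(- R / real (Suc N) ^ 2) * Re (hypo_moment (Suc N) (of_real (-R-1))) \<le> 0"
    using assms Re_hypo_moment_nonneg[of "Suc N" "-R-1"] by (intro mult_nonpos_nonneg) auto
  ultimately show ?thesis by linarith
qed

lemma hypo_moment_positive_bounded:
  assumes "R > 1/2"
  shows "\<exists>C. \<forall>N\<ge>1. Re (hypo_moment N (of_real R)) \<le> C"
proof (intro exI allI impI)
  fix N :: nat assume N: "N \<ge> 1"
  have "norm (dirichlet_sum N (2 * of_real R)) \<le> (\<Sum>n=1..N. real n powr (- 2 * R))"
    unfolding dirichlet_sum_def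
  proof (rule sum_norm_le)
    fix n assume n: "n \<in> {1..N}"
    have "norm (of_real (a_coeff n N) / of_nat n powr (2 * of_real R) :: complex) = \<bar>a_coeff n N\<bar> * real n powr (- 2 * R)"
      using n by (simp add: norm_mult norm_inverse norm_powr_real_powr powr_minus divide_inverse)
    also have "\<dots> \<le> 1 * real n powr (- 2 * R)" by (intro mult_right_mono abs_a_coeff_le_1) auto
    finally show "norm (of_real (a_coeff n N) / of_nat n powr (2 * of_real R) :: complex) \<le> real n powr (- 2 * R)" by simp
  qed
  also have "\<dots> \<le> (\<Sum>n. real n powr (- 2 * R))"
    using assms by (intro sum_le_suminf) (auto simp: summable_real_powr_iff)
  finally have D: "norm (dirichlet_sum N (2 * of_real R)) \<le> (\<Sum>n. real n powr (- 2 * R))" .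
  have "of_real R + 1 \<notin> (\<int>\<^sub>\<le>\<^sub>0 :: complex set)"
    using assms by (auto elim!: nonpos_Ints_cases simp: complex_eq_iff)
  hence "hypo_moment N (of_real R) = - 2 * Gamma (of_real R + 1) * dirichlet_sum N (2 * of_real R)"
    using assms N by (intro hypo_moment_dirichlet_sum) auto
  hence "norm (hypo_moment N (of_real R)) = norm (2 * Gamma (of_real R + 1 :: complex)) * norm (dirichlet_sum N (2 * of_real R))"
    by (simp add: norm_mult)
  also have "\<dots> \<le> norm (2 * Gamma (of_real R + 1 :: complex)) * (\<Sum>n. real n powr (- 2 * R))"
    by (intro mult_left_mono D) auto
  finally show "Re (hypo_moment N (of_real R)) \<le> norm (2 * Gamma (of_real R + 1 :: complex)) * (\<Sum>n. real n powr (- 2 * R))"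
    using complex_Re_le_cmod order_trans by blast
qed

lemma half_integer_not_Ints: "real k + 1/2 \<notin> \<int>"
proof
  assume "real k + 1/2 \<in> \<int>"
  then obtain m where "real k + 1/2 = of_int m" by (elim Ints_cases)
  hence "of_int (2 * int k + 1) = (of_int (2 * m) :: real)" by simp
  hence "2 * int k + 1 = 2 * m" by (simp only: of_int_eq_iff)
  thus False by presburger
qed

text \<open>
  The uniform bound behind the convergence. The half-integer \<open>R = k + 1/2\<close> keeps the recursion away from
  the poles of the Gamma function, and \<open>N > k\<close> ensures that the moment of order \<open>- R\<close> exists.
\<close>
lemma hypo_moment_bounded:
  assumes "k \<ge> 1"
  shows "\<exists>C. \<forall>N\<ge>Suc k. \<forall>w. \<bar>Re w\<bar> \<le> real k + 1/2 \<longrightarrow> norm (hypo_moment N w) \<le> C"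
proof -
  define R where "R = real k + 1/2"
  have R: "R > 1/2" "R \<notin> \<int>" "R < real (Suc k)"
    using assms half_integer_not_Ints[of k] by (auto simp: R_def)
  obtain C where C: "\<And>N. N \<ge> 1 \<Longrightarrow> Re (hypo_moment N (of_real R)) \<le> C"
    using hypo_moment_positive_bounded[OF R(1)] by blast
  have dec: "Re (hypo_moment N (of_real (-R))) \<le> Re (hypo_moment (Suc k) (of_real (-R)))" if "N \<ge> Suc k" for N
    using that
  proof (induction N rule: dec_induct)
    case (step N)
    thus ?case using hypo_moment_negative_antimono[of N R] R by auto
  qed simp
  have "norm (hypo_moment N w) \<le> Re (hypo_moment (Suc k) (of_real (-R))) + C"
    if "N \<ge> Suc k" "\<bar>Re w\<bar> \<le> R" for N w
    using norm_hypo_moment_le[of N w R] dec[of N] C[of N] that R by auto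
  thus ?thesis unfolding R_def by blast
qed

text \<open>
  The telescoping series of the increments \<open>D\<^sub>N\<^sub>+\<^sub>1(s - 2) / (N + 1)\<^sup>2\<close> is dominated by a multiple of
  \<open>\<Sum>N. 1 / N\<^sup>2\<close>.
\<close>
lemma dirichlet_sum_uniformly_convergent:
  assumes K: "compact K"
  shows "uniformly_convergent_on K dirichlet_sum"
proof -
  obtain \<rho> where \<rho>: "\<And>s. s \<in> K \<Longrightarrow> norm s \<le> \<rho>"
    using compact_imp_bounded[OF K] by (auto simp: bounded_iff)
  \<comment> \<open>Large enough that \<open>\<bar>Re (s / 2 - 1)\<bar> \<le> k\<close> for all \<open>s\<close> in \<open>K\<close>.\<close>
  define k where "k = nat \<lceil>\<rho> / 2 + 1\<rceil> + 1"
  have k: "k \<ge> 1" "\<rho> / 2 + 1 \<le> real k" by (auto simp: k_def) linarith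
  obtain C where C: "\<And>N w. N \<ge> Suc k \<Longrightarrow> \<bar>Re w\<bar> \<le> real k + 1/2 \<Longrightarrow> norm (hypo_moment N w) \<le> C"
    using hypo_moment_bounded[OF k(1)] by blast
  have "compact ((\<lambda>s. rGamma (s / 2)) ` K)"
    by (intro compact_continuous_image K holomorphic_on_imp_continuous_on holomorphic_rGamma' holomorphic_intros) auto
  then obtain G where G: "\<And>s. s \<in> K \<Longrightarrow> norm (rGamma (s / 2)) \<le> G"
    using compact_imp_bounded by (fastforce simp: bounded_iff)
  define d where "d = (\<lambda>i s. dirichlet_sum (Suc (i + Suc k)) (s - 2) / of_nat (Suc (i + Suc k)) ^ 2)"
  have partial: "dirichlet_sum (m + Suc k) s = dirichlet_sum (Suc k) s + (\<Sum>i<m. d i s)" for m s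
  proof (induction m)
    case (Suc m)
    show ?case using dirichlet_sum_Suc[of "m + Suc k" s] Suc.IH by (simp add: d_def)
  qed simp
  have "uniformly_convergent_on K (\<lambda>m s. \<Sum>i<m. d i s)"
  proof (rule Weierstrass_m_test')
    fix i s assume s: "s \<in> K"
    let ?N = "Suc (i + Suc k)"
    have "\<bar>Re s\<bar> \<le> \<rho>" using \<rho>[OF s] abs_Re_le_cmod[of s] by linarith
    hence Re: "\<bar>Re (s / 2 - 1)\<bar> \<le> real k" using k by (auto simp: abs_le_iff field_simps)
    have "dirichlet_sum ?N (s - 2) = - (1/2) * rGamma (s / 2) * hypo_moment ?N (s / 2 - 1)"
      using dirichlet_sum_hypo_moment[of ?N "s / 2 - 1"] Re by (simp add: algebra_simps)
    hence "norm (dirichlet_sum ?N (s - 2)) = 1/2 * norm (rGamma (s / 2)) * norm (hypo_moment ?N (s / 2 - 1))"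
      by (simp add: norm_mult)
    also have "\<dots> \<le> 1/2 * G * C"
      using Re order_trans[OF norm_ge_zero G[OF s]]
      by (intro mult_mono G[OF s] C mult_left_mono mult_nonneg_nonneg) auto
    finally have "norm (dirichlet_sum ?N (s - 2)) \<le> 1/2 * G * C" .
    hence "norm (dirichlet_sum ?N (s - 2)) * (1 / real ?N ^ 2) \<le> 1/2 * G * C * (1 / real ?N ^ 2)"
      by (intro mult_right_mono) auto
    thus "norm (d i s) \<le> 1/2 * G * C * (1 / real (i + Suc (Suc k)) ^ 2)"
      by (simp add: d_def norm_divide norm_power del: of_nat_Suc)
  next
    have "summable (\<lambda>i. 1 / real (i + Suc (Suc k)) ^ 2)"
      using inverse_power_summable[of 2, where 'a=real]
      by (subst summable_iff_shift[of "\<lambda>i. 1 / real i ^ 2"]) (simp add: inverse_eq_divide)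
    thus "summable (\<lambda>i. 1/2 * G * C * (1 / real (i + Suc (Suc k)) ^ 2))" by (rule summable_mult)
  qed
  then obtain L where "uniform_limit K (\<lambda>m s. \<Sum>i<m. d i s) L sequentially"
    unfolding uniformly_convergent_on_def by blast
  hence "uniform_limit K (\<lambda>m s. dirichlet_sum (Suc k) s + (\<Sum>i<m. d i s)) (\<lambda>s. dirichlet_sum (Suc k) s + L s) sequentially"
    by (intro uniform_limit_intros)
  hence shifted: "uniform_limit K (\<lambda>m. dirichlet_sum (m + Suc k)) (\<lambda>s. dirichlet_sum (Suc k) s + L s) sequentially"
    unfolding partial .
  have "uniform_limit K dirichlet_sum (\<lambda>s. dirichlet_sum (Suc k) s + L s) sequentially"
    unfolding uniform_limit_iff
  proof (intro allI impI)
    fix e :: real assume "e > 0"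
    with shifted have "\<forall>\<^sub>F m in sequentially. \<forall>s\<in>K. dist (dirichlet_sum (m + Suc k) s) (dirichlet_sum (Suc k) s + L s) < e"
      unfolding uniform_limit_iff by blast
    thus "\<forall>\<^sub>F N in sequentially. \<forall>s\<in>K. dist (dirichlet_sum N s) (dirichlet_sum (Suc k) s + L s) < e"
      by (subst (asm) eventually_sequentially_seg)
  qed
  thus ?thesis unfolding uniformly_convergent_on_def by blast
qed

definition dirichlet_limit :: "complex \<Rightarrow> complex" where
  "dirichlet_limit s = lim (\<lambda>N. dirichlet_sum N s)"

lemma uniform_limit_dirichlet_sum:
  assumes "compact K"
  shows "uniform_limit K dirichlet_sum dirichlet_limit sequentially"
  using dirichlet_sum_uniformly_convergent[OF assms]
  unfolding uniformly_convergent_uniform_limit_iff dirichlet_limit_def .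

lemma dirichlet_limit_holomorphic: "dirichlet_limit holomorphic_on UNIV"
proof (rule holomorphic_uniform_sequence)
  show "\<exists>d>0. cball x d \<subseteq> UNIV \<and> uniform_limit (cball x d) dirichlet_sum dirichlet_limit sequentially" for x
    by (intro exI[of _ 1]) (auto intro: uniform_limit_dirichlet_sum)
qed (auto intro: dirichlet_sum_holomorphic)

text \<open>
  Tannery's theorem: the terms converge to those of the alternating series and are dominated by the terms
  of the absolutely convergent zeta series.
\<close>
lemma dirichlet_limit_eq:
  assumes s: "Re s > 1"
  shows "dirichlet_limit s = (2 powr (1 - s) - 1) * zeta_right s"
proof -
  let ?a = "\<lambda>k N. if k < N then of_real (a_coeff (Suc k) N) / of_nat (Suc k) powr s else (0::complex)"
  let ?M = "\<lambda>k. norm (1 / of_nat (Suc k) powr s :: complex)"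
  have "(\<lambda>N. suminf (\<lambda>k. ?a k N)) \<longlonglongrightarrow> (\<Sum>k. (-1) ^ Suc k / of_nat (Suc k) powr s)"
  proof (rule tannerys_theorem[THEN conjunct2, THEN conjunct2])
    fix k
    have "(\<lambda>N. complex_of_real (a_coeff (Suc k) N) / of_nat (Suc k) powr s) \<longlonglongrightarrow> of_real ((-1) ^ Suc k) / of_nat (Suc k) powr s"
      by (intro tendsto_intros a_coeff_tendsto) (simp del: of_nat_Suc)
    moreover have "\<forall>\<^sub>F N in sequentially. of_real (a_coeff (Suc k) N) / of_nat (Suc k) powr s = ?a k N"
      using eventually_gt_at_top[of k] by eventually_elim simp
    ultimately show "(\<lambda>N. ?a k N) \<longlonglongrightarrow> (-1) ^ Suc k / of_nat (Suc k) powr s"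
      by (simp add: tendsto_cong)
  next
    have "norm (?a k N) \<le> ?M k" for k N
      using abs_a_coeff_le_1[of "Suc k" N] by (auto simp: norm_divide divide_right_mono)
    thus "\<forall>\<^sub>F (k, N) in sequentially \<times>\<^sub>F sequentially. norm (?a k N) \<le> ?M k"
      by (intro always_eventually) auto
  qed (use summable_dirichlet[OF s] in auto)
  also have "(\<lambda>N. suminf (\<lambda>k. ?a k N)) = (\<lambda>N. dirichlet_sum N s)"
  proof
    fix N
    have "suminf (\<lambda>k. ?a k N) = (\<Sum>k<N. ?a k N)" by (intro suminf_finite) auto
    also have "\<dots> = (\<Sum>n=1..N. of_real (a_coeff n N) / of_nat n powr s)"
      by (rule sum.reindex_bij_witness[of _ "\<lambda>n. n - 1" Suc]) auto
    finally show "suminf (\<lambda>k. ?a k N) = dirichlet_sum N s" unfolding dirichlet_sum_def .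
  qed
  finally have "(\<lambda>N. dirichlet_sum N s) \<longlonglongrightarrow> (2 powr (1 - s) - 1) * zeta_right s"
    using sums_unique[OF alternating_dirichlet_sums[OF s]] by simp
  thus ?thesis unfolding dirichlet_limit_def by (rule limI)
qed

lemma entire_zeta_eq: "entire_zeta = dirichlet_limit"
proof
  fix s
  note zeta = zeta_continuation[OF dirichlet_limit_holomorphic dirichlet_limit_eq]
  have eq: "dirichlet_limit z = (2 powr (1 - z) - 1) * zeta z" if "z \<noteq> 1" for z
  proof (rule analytic_continuation_open[of "{z. Re z > 1}" "- {1}" dirichlet_limit "\<lambda>z. (2 powr (1 - z) - 1) * zeta z"])
    show "connected (- {1::complex})" by (intro connected_punctured_universe) auto
    show "(\<lambda>z. (2 powr (1 - z) - 1) * zeta z) holomorphic_on - {1}"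
      by (intro holomorphic_intros zeta(1)) auto
    show "{z. Re z > 1} \<noteq> {}" by (auto intro: exI[of _ 2])
    show "dirichlet_limit z = (2 powr (1 - z) - 1) * zeta z" if "z \<in> {z. Re z > 1}" for z
      using that by (simp add: zeta(2) dirichlet_limit_eq)
  qed (use that in \<open>auto intro: open_halfspace_Re_gt holomorphic_on_subset[OF dirichlet_limit_holomorphic]\<close>)
  have "isCont dirichlet_limit s"
    using dirichlet_limit_holomorphic by (meson UNIV_I continuous_on_eq_continuous_at holomorphic_on_imp_continuous_on open_UNIV)
  hence "dirichlet_limit \<midarrow>s\<rightarrow> dirichlet_limit s" by (simp add: isCont_def)
  moreover have "\<forall>\<^sub>F z in at s. dirichlet_limit z = (2 powr (1 - z) - 1) * zeta z"
    using eventually_neq_at_within[of 1 s UNIV] by eventually_elim (rule eq)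
  ultimately have "(\<lambda>z. (2 powr (1 - z) - 1) * zeta z) \<midarrow>s\<rightarrow> dirichlet_limit s"
    by (rule Lim_transform_eventually)
  thus "entire_zeta s = dirichlet_limit s" unfolding entire_zeta_def by (rule remove_sings_eqI)
qed

section \<open>Moments and convergence\<close>

theorem theorem3:
  shows "(\<forall>N \<ge> 1. \<forall>(M :: 'a measure) (\<epsilon> :: nat \<Rightarrow> 'a \<Rightarrow> real) (s :: complex).
            prob_space M
            \<longrightarrow> prob_space.indep_vars M (\<lambda>_. borel) \<epsilon> {1..N}
            \<longrightarrow> (\<forall>n \<in> {1..N}. distributed M lborel (\<epsilon> n) (exponential_density 1))
            \<longrightarrow> Re s > - 2 * real N
            \<longrightarrow> integrable M (\<lambda>\<omega>. complex_of_real (2 / pi\<^sup>2 * (\<Sum>n=1..N. \<epsilon> n \<omega> / (real n)\<^sup>2)) powr (s / 2))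
              \<and> prob_space.expectation M
                  (\<lambda>\<omega>. complex_of_real (2 / pi\<^sup>2 * (\<Sum>n=1..N. \<epsilon> n \<omega> / (real n)\<^sup>2)) powr (s / 2))
                = moment_formula N s)
       \<and> (\<forall>K :: complex set. compact K \<longrightarrow> uniform_limit K dirichlet_sum entire_zeta sequentially)"
proof (intro conjI allI impI)
  fix N :: nat and M :: "'a measure" and \<epsilon> :: "nat \<Rightarrow> 'a \<Rightarrow> real" and s :: complex
  assume N: "1 \<le> N" and "prob_space M" and indep: "prob_space.indep_vars M (\<lambda>_. borel) \<epsilon> {1..N}"
    and exp: "\<forall>n\<in>{1..N}. distributed M lborel (\<epsilon> n) (exponential_density 1)"
    and s: "Re s > - 2 * real N"
  interpret prob_space M by fact
  have S: "distributed M lborel (\<lambda>\<omega>. \<Sum>n=1..N. \<epsilon> n \<omega> / (real n)\<^sup>2) (hypo_density N)"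
    using exp by (intro distributed_hypo_density N indep) auto
  show "integrable M (\<lambda>\<omega>. complex_of_real (2 / pi\<^sup>2 * (\<Sum>n=1..N. \<epsilon> n \<omega> / (real n)\<^sup>2)) powr (s / 2))"
    "expectation (\<lambda>\<omega>. complex_of_real (2 / pi\<^sup>2 * (\<Sum>n=1..N. \<epsilon> n \<omega> / (real n)\<^sup>2)) powr (s / 2)) = moment_formula N s"
    using hypo_sum_expectation[OF N s S] by blast+
next
  fix K :: "complex set" assume "compact K"
  thus "uniform_limit K dirichlet_sum entire_zeta sequentially"
    unfolding entire_zeta_eq by (rule uniform_limit_dirichlet_sum)
qed

end
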